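(* Let $m\geq3$ and for $i=1,\ldots,m$ let $\chi_i$ be a Dirichlet character modulo $q_i$; put $\chi=\chi_1\cdots\chi_m$ and $q^*=\max(q_1,\ldots,q_m)$. Then for any Dirichlet character $\psi$ modulo $\ell$ and any $\varepsilon>0$, $$\sum_{b=1}^{\ell-1}\psi(b)\prod_{i=1}^mL\left(\chi_i,b/\ell,\tfrac12\right)=\ell^{m/2}L\left(\chi\psi,\tfrac m2\right)+O_{m,\varepsilon}\big((q^* )^{m/4+\varepsilon}\ell+(q^* )^{1/4+\varepsilon}\ell^{m/2-1/2+\varepsilon}\big).$$
   Context: For a Dirichlet character $\chi$ and integers $b,\ell\geq1$, $L(\chi,b/\ell,s):=\ell^s\sum_{n\geq1,\ n\equiv b\bmod\ell}\chi(n)n^{-s}$ for $\mathrm{Re}\, s>1$, extended meromorphically in $s$. $L(\chi,s)=\sum_{n\geq1}\chi(n)n^{-s}$; $\chi\psi$ is the product character. *)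

theory Defs
  imports "HOL-Complex_Analysis.Complex_Analysis"
begin

definition dirichlet_character :: "nat \<Rightarrow> (nat \<Rightarrow> complex) \<Rightarrow> bool" where
  "dirichlet_character q chi \<longleftrightarrow> q > 0 \<and> (\<forall>n. chi (n + q) = chi n) \<and>
     (\<forall>a b. chi (a * b) = chi a * chi b) \<and> chi 1 = 1 \<and>
     (\<forall>n. chi n \<noteq> 0 \<longleftrightarrow> coprime n q)"

text \<open>Value at s of the analytic continuation to C minus {1} of a function f
  given on the half plane Re s > 1 (well defined for s \<noteq> 1 by the identity theorem).\<close>
definition cont_value :: "(complex \<Rightarrow> complex) \<Rightarrow> complex \<Rightarrow> complex" where
  "cont_value f s = (THE w. \<exists>g. g holomorphic_on (- {1}) \<and>
      (\<forall>z. 1 < Re z \<longrightarrow> g z = f z) \<and> g s = w)"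

definition hurwitz_series :: "(nat \<Rightarrow> complex) \<Rightarrow> nat \<Rightarrow> nat \<Rightarrow> complex \<Rightarrow> complex" where
  "hurwitz_series chi b l s = of_nat l powr s *
     infsum (\<lambda>n. chi n / of_nat n powr s) {n. 1 \<le> n \<and> n mod l = b mod l}"

definition hurwitz_L :: "(nat \<Rightarrow> complex) \<Rightarrow> nat \<Rightarrow> nat \<Rightarrow> complex \<Rightarrow> complex" where
  "hurwitz_L chi b l s = cont_value (hurwitz_series chi b l) s"

definition dirichlet_L :: "(nat \<Rightarrow> complex) \<Rightarrow> complex \<Rightarrow> complex" where
  "dirichlet_L chi s = cont_value (\<lambda>z. infsum (\<lambda>n. chi n / of_nat n powr z) {n. 1 \<le> n}) s"

end

theory Submission
  imports Defs "HOL-Number_Theory.Number_Theory" "HOL-Real_Asymp.Real_Asymp"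
begin

text \<open>
  Splitting off the first term gives
  \<open>L(\<chi>, b/l, 1/2) = \<chi>(b) (l/b)\<^sup>1\<^sup>/\<^sup>2 + R\<close>, and everything rests on the convexity-type bound
  \<open>R = O(q\<^sup>1\<^sup>/\<^sup>4\<^sup>+\<^sup>\<epsilon>)\<close>, uniform in \<open>b\<close> and \<open>l\<close>: multiplying out the product over \<open>i\<close>, the main terms sum to
  a truncation of \<open>l\<^sup>m\<^sup>/\<^sup>2 L(\<chi>\<psi>, m/2)\<close> and the rest is bounded termwise. By partial summation the
  bound on \<open>R\<close> follows from a Polya--Vinogradov inequality for \<open>k \<mapsto> \<chi>(b + k l)\<close>. No
  primitivity and no coprimality of \<open>l\<close> and \<open>q\<close> is needed for the latter: the modulus of the discrete Fourier
  transform is invariant under multiplication of the frequency by units congruent to 1 modulo \<open>gcd(l, q)\<close>, so that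
  Parseval's identity bounds it on each orbit.
\<close>

section \<open>Divisor sums\<close>

text \<open>The mean of \<open>chi\<close> along \<open>b + k * l\<close> over a period can have
  modulus 1 (it equals 1 for q = 1), so partial sums are centred at that mean \<open>\<mu>\<close>,
  and the Abel summation must carry an Euler summation of the constant \<open>\<mu>\<close> beside
  it. The centred sums are at most some \<open>A\<close> of size q^(1/2+eps); using the trivial
  bound for the first \<open>A\<close> terms and \<open>A\<close> afterwards turns this into sqrt A,
  which is where the exponent 1/4 comes from. Removing the term n = b before estimating is what
  gives uniformity: the rest starts at (b + l)/l, between 1 and 2, however small b/l is. The values
  at 1/2 are defined through a continuation to the plane without 1, so such a continuation has to be
  built, although the estimate itself lives in Re s > 0. The hypothesis m >= 3 enters twice: m/2 >=
  3/2 puts L(chi psi, m/2) in the range of absolute convergence, with a tail of size l^(1-m/2), and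
  (m-1)/2 >= 1 makes the sum of b^(-(m-1)/2) at most logarithmic.\<close>

lemma card_divisors_mult_le:
  fixes m n :: nat
  assumes "m > 0" "n > 0"
  shows "card {d. d dvd m * n} \<le> card {d. d dvd m} * card {d. d dvd n}"
proof -
  have "{d. d dvd m * n} \<subseteq> (\<lambda>(a, b). a * b) ` ({d. d dvd m} \<times> {d. d dvd n})"
    by (auto elim!: dvd_productE)
  then have "card {d. d dvd m * n} \<le> card ({d. d dvd m} \<times> {d. d dvd n})"
    using assms by (intro surj_card_le) auto
  then show ?thesis by (simp add: card_cartesian_product)
qed

lemma card_divisors_prime_power:
  fixes p :: nat
  assumes "prime p"
  shows "card {d. d dvd p ^ a} = a + 1"
proof -
  have "{d. d dvd p ^ a} = (\<lambda>i. p ^ i) ` {..a}"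
    using assms by (auto simp: divides_primepow_nat)
  moreover have "inj_on (\<lambda>i. p ^ i) {..a}"
    using assms prime_gt_1_nat[OF assms] by (auto simp: inj_on_def)
  ultimately show ?thesis by (simp add: card_image)
qed

text \<open>Prime by prime: the ratio (a + 1) / p^(\<epsilon> a) is at most 1 once p^\<epsilon> >=
  2, and at most \<open>K\<close> for every prime, so only the boundedly many primes below
  \<open>P\<close> = 2^(1/\<epsilon>) cost anything.\<close>

lemma card_divisors_bound:
  fixes \<epsilon> :: real
  assumes "\<epsilon> > 0"
  shows "\<exists>C\<ge>1. \<forall>n>0. real (card {d. d dvd n}) \<le> C * real n powr \<epsilon>"
proof -
  \<comment> \<open>With this \<open>K\<close>, a + 1 is at most K (1 + \<epsilon> ln 2 a), whose
    bracket is the linear minorant of 2^(\<epsilon> a).\<close>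
  define K where "K = 1 + 1 / (\<epsilon> * ln 2)"
  define P where "P = 2 powr (1 / \<epsilon>)"
  have K: "K \<ge> 1" using assms by (simp add: K_def)
  have step_small: "real a + 1 \<le> K * real p powr (\<epsilon> * real a)" if "prime p" for p a :: nat
  proof -
    have "real a + 1 \<le> K * (1 + \<epsilon> * ln 2 * real a)"
      using assms by (simp add: K_def field_simps)
    also have "1 + \<epsilon> * ln 2 * real a \<le> exp (\<epsilon> * ln 2 * real a)"
      by (rule exp_ge_add_one_self)
    also have "exp (\<epsilon> * ln 2 * real a) = 2 powr (\<epsilon> * real a)"
      by (simp add: powr_def mult_ac)
    also have "\<dots> \<le> real p powr (\<epsilon> * real a)"
      using assms prime_ge_2_nat[OF that] by (intro powr_mono2) auto
    finally show ?thesis using K by (simp add: mult_left_mono)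
  qed
  have step_large: "real a + 1 \<le> real p powr (\<epsilon> * real a)" if "real p \<ge> P" for p a :: nat
  proof -
    have "2 = P powr \<epsilon>" using assms by (simp add: P_def powr_powr)
    also have "\<dots> \<le> real p powr \<epsilon>"
      using assms that by (intro powr_mono2) (auto simp: P_def)
    finally have "2 ^ a \<le> (real p powr \<epsilon>) ^ a" by (intro power_mono) auto
    also have "(real p powr \<epsilon>) ^ a = real p powr (\<epsilon> * real a)"
      proof -
      have "P > 0" by (simp add: P_def)
      then have "real p > 0" using that by linarith
      then have "real p powr \<epsilon> > 0" by simp
      then show ?thesis by (simp add: powr_realpow[symmetric] powr_powr)
    qed
    finally have 1: "2 ^ a \<le> real p powr (\<epsilon> * real a)" .
    have "a + 1 \<le> 2 ^ a" using less_exp[of a] by (simp add: Suc_le_eq)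
    then have "real (a + 1) \<le> real (2 ^ a)" by (rule of_nat_mono)
    then show ?thesis using 1 by simp
  qed
  \<comment> \<open>The exponent of \<open>K\<close> counts only the small primes dividing
    \<open>n\<close>; stripping a full prime power removes one of them precisely when that prime is
    small.\<close>
  define S where "S = (\<lambda>n::nat. {p. prime p \<and> p dvd n \<and> real p < P})"
  have finP: "finite {p::nat. real p < P}"
    by (rule finite_subset[of _ "{..nat \<lceil>P\<rceil>}"]) (auto, linarith)
  have finS: "finite (S n)" for n by (rule finite_subset[OF _ finP]) (auto simp: S_def)
  have main: "real (card {d. d dvd n}) \<le> K ^ card (S n) * real n powr \<epsilon>" if "n > 0" for n
    using that
  proof (induction n rule: less_induct)
    case (less n)
    show ?case
    proof (cases "n = 1")
      case True
      have "S 1 = {}" by (auto simp: S_def)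
      then show ?thesis using True by simp
    next
      case False
      then obtain p where p: "prime p" "p dvd n" using prime_factor_nat by blast
      define a where "a = multiplicity p n"
      obtain m where m: "n = p ^ a * m" "\<not> p dvd m"
        using multiplicity_decompose'[of n p] less.prems p unfolding a_def
        by (metis less_not_refl2 not_prime_unit)
      have a: "a > 0" using p m(1,2) by (cases a) auto
      have m0: "m > 0" using less.prems m by (cases m) auto
      have pa: "p ^ a > 1" using one_less_power[OF prime_gt_1_nat[OF p(1)] a] .
      then have mn: "m < n" using m0 m(1) by simp
      have IH: "real (card {d. d dvd m}) \<le> K ^ card (S m) * real m powr \<epsilon>"
        using less.IH[OF mn m0] .
      have "card {d. d dvd n} \<le> (a + 1) * card {d. d dvd m}"
        using card_divisors_mult_le[of "p ^ a" m] m0 pa card_divisors_prime_power[OF p(1), of a]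
          prime_gt_0_nat[OF p(1)]
        unfolding m(1) by simp
      then have "real (card {d. d dvd n}) \<le> real ((a + 1) * card {d. d dvd m})" by (rule of_nat_mono)
      also have "\<dots> = (real a + 1) * real (card {d. d dvd m})" by (simp add: algebra_simps)
      also have "\<dots> \<le> (real a + 1) * (K ^ card (S m) * real m powr \<epsilon>)"
        using IH by (intro mult_left_mono) auto
      finally have 1: "real (card {d. d dvd n}) \<le> (real a + 1) * (K ^ card (S m) * real m powr \<epsilon>)" .
      have pow: "real n powr \<epsilon> = real p powr (\<epsilon> * real a) * real m powr \<epsilon>"
        using p(1) prime_gt_0_nat[OF p(1)]
        by (simp add: m(1) powr_mult powr_powr mult_ac flip: powr_realpow)
      have "(real a + 1) * K ^ card (S m) \<le> K ^ card (S n) * real p powr (\<epsilon> * real a)"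
      proof (cases "real p < P")
        case True
        have "insert p (S m) \<subseteq> S n" using True p m by (auto simp: S_def)
        moreover have "p \<notin> S m" using m by (auto simp: S_def)
        ultimately have "Suc (card (S m)) \<le> card (S n)"
          using finS by (metis card_insert_disjoint card_mono)
        then have "K * K ^ card (S m) \<le> K ^ card (S n)"
          using K by (metis power_Suc power_increasing)
        then have "K * K ^ card (S m) * real p powr (\<epsilon> * real a) \<le> K ^ card (S n) * real p powr (\<epsilon> * real a)"
          by (intro mult_right_mono) auto
        moreover have "(real a + 1) * K ^ card (S m) \<le> K * real p powr (\<epsilon> * real a) * K ^ card (S m)"
          using step_small[OF p(1), of a] K by (intro mult_right_mono) auto
        ultimately show ?thesis by (simp add: mult_ac)
      next
        case False
        have "S m \<subseteq> S n" using m by (auto simp: S_def)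
        then have "K ^ card (S m) \<le> K ^ card (S n)"
          using K finS by (intro power_increasing card_mono) auto
        moreover have "real a + 1 \<le> real p powr (\<epsilon> * real a)"
          using False by (intro step_large) auto
        ultimately have "K ^ card (S m) * (real a + 1) \<le> K ^ card (S n) * real p powr (\<epsilon> * real a)"
          using K by (intro mult_mono) auto
        then show ?thesis by (simp add: mult_ac)
      qed
      then have "(real a + 1) * K ^ card (S m) * real m powr \<epsilon>
          \<le> K ^ card (S n) * real p powr (\<epsilon> * real a) * real m powr \<epsilon>"
        by (intro mult_right_mono) auto
      then show ?thesis using 1 by (simp add: pow mult_ac)
    qed
  qed
  define C where "C = K ^ card {p::nat. real p < P}"
  have "real (card {d. d dvd n}) \<le> C * real n powr \<epsilon>" if "n > 0" for n
  proof -
    have "K ^ card (S n) \<le> C"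
      unfolding C_def using K finP by (intro power_increasing card_mono) (auto simp: S_def)
    then have "K ^ card (S n) * real n powr \<epsilon> \<le> C * real n powr \<epsilon>"
      by (intro mult_right_mono) auto
    with main[OF that] show ?thesis by linarith
  qed
  moreover have "C \<ge> 1" using K by (simp add: C_def)
  ultimately show ?thesis by blast
qed

text \<open>Read as a lower bound for the totient that loses only a divisor count, hence only q^eps:
  in Gauss's identity no summand exceeds \<open>totient n\<close>.\<close>

lemma le_totient_mult_card_divisors:
  assumes "n > 0"
  shows "n \<le> totient n * card {d. d dvd n}"
proof -
  have "n = (\<Sum>d | d dvd n. totient d)" by (simp add: totient_divisor_sum)
  also have "\<dots> \<le> (\<Sum>d | d dvd n. totient n)"
    using assms by (intro sum_mono totient_dvd_mono) auto
  finally show ?thesis by (simp add: mult.commute)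
qed

lemma harm_le_ln:
  assumes "n > 0"
  shows "(harm n :: real) \<le> 1 + ln (real n)"
proof -
  have "harm (Suc (n - 1)) - ln (real (Suc (n - 1))) \<le> harm (Suc 0) - ln (real (Suc 0))"
    by (rule decseqD[OF decseq_harm_diff_ln]) simp
  then show ?thesis using assms by (simp add: harm_def)
qed

text \<open>Terms with gcd g have t = g k and equal 1/k, so each divisor g contributes at most a
  harmonic sum. Hence a loss of gcd t q in a Fourier coefficient is harmless after summation against
  1/t.\<close>

lemma sum_gcd_div_le:
  fixes n :: nat
  assumes "n > 0"
  shows "(\<Sum>t\<in>{1..<n}. real (gcd t n) / real t) \<le> real (card {d. d dvd n}) * (1 + ln (real n))"
proof -
  have "(\<Sum>t\<in>{1..<n}. real (gcd t n) / real t)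
      = (\<Sum>g | g dvd n. \<Sum>t | t \<in> {1..<n} \<and> gcd t n = g. real (gcd t n) / real t)"
    using assms by (intro sum.group[symmetric]) auto
  also have "\<dots> \<le> (\<Sum>g | g dvd n. 1 + ln (real n))"
  proof (rule sum_mono)
    fix g assume "g \<in> {g. g dvd n}"
    then have g: "g > 0" using assms by (auto intro!: Nat.gr0I)
    have "(\<Sum>t | t \<in> {1..<n} \<and> gcd t n = g. real (gcd t n) / real t)
        \<le> (\<Sum>t\<in>(*) g ` {1..n}. real g / real t)"
    proof (rule order_trans[OF eq_refl sum_mono2])
      show "(\<Sum>t | t \<in> {1..<n} \<and> gcd t n = g. real (gcd t n) / real t)
         = (\<Sum>t | t \<in> {1..<n} \<and> gcd t n = g. real g / real t)"
        by (intro sum.cong) auto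
      show "{t. t \<in> {1..<n} \<and> gcd t n = g} \<subseteq> (*) g ` {1..n}"
      proof
        fix t assume t: "t \<in> {t. t \<in> {1..<n} \<and> gcd t n = g}"
        then have "g dvd t" by auto
        then obtain k where k: "t = g * k" by auto
        moreover have "k \<ge> 1" using t k by (cases k) auto
        moreover have "k \<le> n"
        proof -
          have "k \<le> g * k" using g by simp
          also have "g * k < n" using t k by simp
          finally show ?thesis by simp
        qed
        ultimately show "t \<in> (*) g ` {1..n}" by auto
      qed
    qed auto
    also have "\<dots> = (\<Sum>k\<in>{1..n}. real g / real (g * k))"
      using g by (subst sum.reindex) (auto simp: inj_on_def)
    also have "\<dots> = harm n"
      unfolding harm_def using g by (intro sum.cong) (auto simp: field_simps)
    also have "\<dots> \<le> 1 + ln (real n)" by (rule harm_le_ln[OF assms])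
    finally show "(\<Sum>t | t \<in> {1..<n} \<and> gcd t n = g. real (gcd t n) / real t) \<le> 1 + ln (real n)" .
  qed
  finally show ?thesis by simp
qed

section \<open>Incomplete character sums in arithmetic progressions\<close>

lemma periodic_add_mult:
  fixes f :: "nat \<Rightarrow> 'a"
  assumes "\<And>k. f (k + q) = f k"
  shows "f (k + q * i) = f k"
proof (induction i)
  case (Suc i)
  have "k + q * Suc i = (k + q * i) + q" by simp
  then show ?case using Suc assms by metis
qed simp

lemma periodic_mod:
  fixes f :: "nat \<Rightarrow> 'a"
  assumes "\<And>k. f (k + q) = f k"
  shows "f (k mod q) = f k"
  using periodic_add_mult[of f, OF assms, of "k mod q" "k div q"] by simp

lemma periodic_cong:
  fixes f :: "nat \<Rightarrow> 'a"
  assumes "\<And>k. f (k + q) = f k" "[a = b] (mod q)"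
  shows "f a = f b"
  using periodic_mod[of f q, OF assms(1)] assms(2) unfolding cong_def by metis

lemma sum_periodic_affine:
  fixes f :: "nat \<Rightarrow> 'a::comm_monoid_add"
  assumes per: "\<And>k. f (k + q) = f k" and "coprime u q" "q > 0"
  shows "(\<Sum>k<q. f (u * k + c)) = (\<Sum>k<q. f k)"
proof -
  let ?h = "\<lambda>k. (u * k + c) mod q"
  have inj: "inj_on ?h {..<q}"
  proof (rule inj_onI)
    fix x y assume xy: "x \<in> {..<q}" "y \<in> {..<q}" "?h x = ?h y"
    then have "[u * x + c = u * y + c] (mod q)" by (simp add: cong_def)
    then have "[u * x = u * y] (mod q)" by (simp add: cong_add_rcancel_nat)
    then have "[x = y] (mod q)" using assms(2) by (simp add: cong_mult_lcancel_nat)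
    then show "x = y" using xy by (simp add: cong_def)
  qed
  have "?h ` {..<q} = {..<q}"
    using assms(3) by (intro card_subset_eq) (auto simp: card_image[OF inj])
  then have "(\<Sum>k<q. f k) = (\<Sum>k\<in>?h ` {..<q}. f k)" by simp
  also have "\<dots> = (\<Sum>k<q. f (?h k))" by (simp add: sum.reindex[OF inj])
  also have "\<dots> = (\<Sum>k<q. f (u * k + c))" by (simp add: periodic_mod[of f q, OF per])
  finally show ?thesis by simp
qed

lemma dirichlet_characterD:
  assumes "dirichlet_character q chi"
  shows "q > 0" "chi (n + q) = chi n" "chi (a * b) = chi a * chi b" "chi 1 = 1"
    "chi n \<noteq> 0 \<longleftrightarrow> coprime n q"
  using assms by (auto simp: dirichlet_character_def)

lemma dirichlet_character_power:
  assumes "dirichlet_character q chi"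
  shows "chi (n ^ k) = chi n ^ k"
  by (induction k) (use dirichlet_characterD[OF assms] in auto)

lemma norm_dirichlet_character:
  assumes "dirichlet_character q chi" "coprime n q"
  shows "norm (chi n) = 1"
proof -
  note D = dirichlet_characterD[OF assms(1)]
  have "[n ^ totient q = 1] (mod q)" using assms(2) by (rule euler_theorem)
  then have "chi (n ^ totient q) = chi 1" by (rule periodic_cong[of chi q, OF D(2)])
  then have "chi n ^ totient q = 1" using D(4) by (simp add: dirichlet_character_power[OF assms(1)])
  then have "norm (chi n) ^ totient q = 1" by (metis norm_one norm_power)
  then show ?thesis using D(1) power_eq_imp_eq_base[of "norm (chi n)" "totient q" 1] by simp
qed

lemma norm_dirichlet_character_le:
  assumes "dirichlet_character q chi"
  shows "norm (chi n) \<le> 1"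
  using norm_dirichlet_character[OF assms] dirichlet_characterD(5)[OF assms]
  by (metis norm_zero order_refl zero_le_one)

section \<open>Additive characters e(x/q) and their geometric sums\<close>

definition root_exp :: "nat \<Rightarrow> int \<Rightarrow> complex" where
  "root_exp q x = cis (2 * pi * real_of_int x / real q)"

lemma norm_root_exp [simp]: "norm (root_exp q x) = 1"
  by (simp add: root_exp_def)

lemma root_exp_add: "root_exp q (x + y) = root_exp q x * root_exp q y"
  by (simp add: root_exp_def cis_mult add_divide_distrib ring_distribs)

lemma root_exp_0 [simp]: "root_exp q 0 = 1"
  by (simp add: root_exp_def)

lemma root_exp_minus: "root_exp q (- x) = cnj (root_exp q x)"
  by (simp add: root_exp_def cis_cnj)

lemma root_exp_power: "root_exp q x ^ n = root_exp q (x * int n)"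
  unfolding root_exp_def Complex.DeMoivre by (simp add: field_simps)

lemma root_exp_eq_1_iff:
  assumes "q > 0"
  shows "root_exp q x = 1 \<longleftrightarrow> int q dvd x"
proof
  assume "root_exp q x = 1"
  then have "cos (2 * pi * real_of_int x / real q) = 1"
    by (metis root_exp_def cis.simps(1) one_complex.simps(1))
  then obtain n where n: "2 * pi * real_of_int x / real q = real_of_int n * 2 * pi"
    unfolding cos_one_2pi_int by auto
  then have "real_of_int x = real_of_int n * real q" using assms by (simp add: field_simps)
  then have "real_of_int x = real_of_int (n * int q)" by simp
  then have "x = n * int q" by (simp only: of_int_eq_iff)
  then show "int q dvd x" by simp
next
  assume "int q dvd x"
  then obtain n where "x = int q * n" by auto
  then have "2 * pi * real_of_int x / real q = 2 * pi * real_of_int n" using assms by simp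
  then show "root_exp q x = 1" unfolding root_exp_def by simp
qed

lemma root_exp_periodic: "q > 0 \<Longrightarrow> root_exp q (x + int q * y) = root_exp q x"
  by (simp add: root_exp_add root_exp_eq_1_iff[THEN iffD2])

lemma sum_root_exp:
  assumes "q > 0"
  shows "(\<Sum>t<q. root_exp q (x * int t)) = (if int q dvd x then of_nat q else 0)"
proof (cases "int q dvd x")
  case True
  have "root_exp q (x * int t) = 1" for t using True assms by (simp add: root_exp_eq_1_iff)
  then show ?thesis using True by simp
next
  case False
  then have "root_exp q x \<noteq> 1" using assms by (simp add: root_exp_eq_1_iff)
  moreover have "root_exp q x ^ q = 1" using assms by (simp add: root_exp_power root_exp_eq_1_iff)
  ultimately show ?thesis using False by (simp add: root_exp_power[symmetric] geometric_sum)
qed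

lemma norm_root_exp_diff_1:
  "norm (root_exp q x - 1) = 2 * \<bar>sin (pi * (real_of_int x / real q))\<bar>"
  using dist_exp_i_1[of "2 * pi * real_of_int x / real q"]
  by (simp add: root_exp_def cis_conv_exp)

text \<open>Jordan's inequality: by concavity the sine lies above its chord from 0 to pi/2, and pi y
  is the point of that interval with interpolation parameter 2 y.\<close>

lemma sin_pi_lower:
  fixes y :: real
  assumes "0 \<le> y" "y \<le> 1 / 2"
  shows "2 * y \<le> sin (pi * y)"
proof -
  have "convex_on {0..pi} (\<lambda>x. - sin x)"
  proof (rule f''_ge0_imp_convex)
    show "((\<lambda>x. - sin x) has_real_derivative (- cos x)) (at x)" for x :: real
      by (auto intro!: derivative_eq_intros)
    show "((\<lambda>x. - cos x) has_real_derivative (sin x)) (at x)" for x :: real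
      by (auto intro!: derivative_eq_intros)
  qed (auto intro: sin_ge_zero)
  from convex_onD[OF this, of "2 * y" 0 "pi / 2"] assms show ?thesis by (simp add: mult.commute)
qed

text \<open>The geometric sum is at most 2 / |e(t/q) - 1|, and |e(t/q) - 1| = 2 sin(pi t/q) is at
  least 4 times the distance from t/q to the nearest integer. Adding the reciprocals of the
  distances to 0 and to 1 replaces a minimum by an expression symmetric under t -> q - t.\<close>

lemma norm_sum_root_exp_le:
  fixes t q n :: nat
  assumes "0 < t" "t < q"
  shows "norm (\<Sum>k<n. root_exp q (int t * int k)) \<le> real q / 2 * (1 / real t + 1 / real (q - t))"
proof -
  have q: "q > 0" using assms by simp
  define y where "y = real t / real q"
  define z where "z = min y (1 - y)"
  have y: "0 < y" "y < 1" using assms by (auto simp: y_def)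
  have z: "0 < z" "z \<le> 1/2" using y by (auto simp: z_def min_def)
  have "sin (pi * z) = sin (pi * y)"
    by (auto simp: z_def min_def right_diff_distrib sin_diff)
  then have s: "2 * z \<le> sin (pi * y)" using sin_pi_lower[of z] z by simp
  have ne: "root_exp q (int t) \<noteq> 1"
    using assms q by (auto simp: root_exp_eq_1_iff dest: nat_dvd_not_less)
  have den: "norm (root_exp q (int t) - 1) \<ge> 4 * z"
    using s z by (simp add: norm_root_exp_diff_1 flip: y_def)
  have "(\<Sum>k<n. root_exp q (int t * int k)) = (root_exp q (int t) ^ n - 1) / (root_exp q (int t) - 1)"
    using ne by (simp add: root_exp_power[symmetric] geometric_sum)
  then have "norm (\<Sum>k<n. root_exp q (int t * int k))
      = norm (root_exp q (int t) ^ n - 1) / norm (root_exp q (int t) - 1)" by (simp add: norm_divide)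
  also have "norm (root_exp q (int t) ^ n - 1) \<le> 2"
    using norm_triangle_ineq4[of "root_exp q (int t) ^ n" 1] by (simp add: norm_power)
  also have "2 / norm (root_exp q (int t) - 1) \<le> 2 / (4 * z)"
    using den z by (intro divide_left_mono mult_pos_pos) auto
  finally have "norm (\<Sum>k<n. root_exp q (int t * int k)) \<le> 2 / (4 * z)"
    by (simp add: divide_right_mono)
  also have "2 / (4 * z) \<le> 1 / 2 * (1 / y + 1 / (1 - y))"
    using y by (auto simp: z_def min_def)
  also have "\<dots> = real q / 2 * (1 / real t + 1 / real (q - t))"
    using assms by (simp add: y_def field_simps of_nat_diff)
  finally show ?thesis .
qed

section \<open>The discrete Fourier transform modulo q\<close>

definition dft :: "nat \<Rightarrow> (nat \<Rightarrow> complex) \<Rightarrow> nat \<Rightarrow> complex" where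
  "dft q f t = (\<Sum>k<q. f k * root_exp q (- (int k * int t)))"

lemma dft_inversion:
  assumes "n < q"
  shows "f n = (\<Sum>t<q. dft q f t * root_exp q (int t * int n)) / of_nat q"
proof -
  have q: "q > 0" using assms by simp
  have "(\<Sum>t<q. dft q f t * root_exp q (int t * int n))
      = (\<Sum>t<q. \<Sum>k<q. f k * root_exp q ((int n - int k) * int t))"
    unfolding dft_def sum_distrib_right
    by (intro sum.cong refl) (simp add: mult.assoc root_exp_add[symmetric] algebra_simps)
  also have "\<dots> = (\<Sum>k<q. f k * (\<Sum>t<q. root_exp q ((int n - int k) * int t)))"
    by (subst sum.swap) (simp add: sum_distrib_left)
  also have "\<dots> = (\<Sum>k<q. if k = n then f k * of_nat q else 0)"
  proof (intro sum.cong refl)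
    fix k assume "k \<in> {..<q}"
    then have "int q dvd int n - int k \<longleftrightarrow> k = n"
      using assms zdvd_imp_le[of "int q" "int n - int k"] zdvd_imp_le[of "int q" "int k - int n"]
      by (cases k n rule: linorder_cases) (auto simp: dvd_diff_commute)
    then show "f k * (\<Sum>t<q. root_exp q ((int n - int k) * int t)) = (if k = n then f k * of_nat q else 0)"
      using q by (simp add: sum_root_exp)
  qed
  also have "\<dots> = f n * of_nat q" using assms by simp
  finally show ?thesis using q by simp
qed

lemma dft_parseval:
  assumes "q > 0"
  shows "(\<Sum>t<q. (norm (dft q f t))\<^sup>2) = real q * (\<Sum>k<q. (norm (f k))\<^sup>2)"
proof -
  have "(\<Sum>t<q. complex_of_real ((norm (dft q f t))\<^sup>2)) = (\<Sum>t<q. dft q f t * cnj (dft q f t))"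
    by (simp only: complex_norm_square)
  also have "\<dots> = (\<Sum>t<q. \<Sum>k<q. cnj (f k) * (dft q f t * root_exp q (int t * int k)))"
    by (subst (2) dft_def)
       (simp add: sum_distrib_left root_exp_minus mult_ac cong: sum.cong)
  also have "\<dots> = (\<Sum>k<q. cnj (f k) * (\<Sum>t<q. dft q f t * root_exp q (int t * int k)))"
    by (subst sum.swap) (simp add: sum_distrib_left)
  also have "\<dots> = (\<Sum>k<q. cnj (f k) * (of_nat q * f k))"
  proof (intro sum.cong refl)
    fix k assume "k \<in> {..<q}"
    then show "cnj (f k) * (\<Sum>t<q. dft q f t * root_exp q (int t * int k)) = cnj (f k) * (of_nat q * f k)"
      using dft_inversion[of k q f] assms by (simp add: field_simps)
  qed
  also have "\<dots> = complex_of_real (real q * (\<Sum>k<q. (norm (f k))\<^sup>2))"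
    by (simp only: sum_distrib_left of_real_mult of_real_sum complex_norm_square of_real_of_nat_eq mult_ac)
  finally show ?thesis by (simp only: of_real_sum[symmetric] of_real_eq_iff)
qed

text \<open>A symmetry of \<open>f\<close> under k -> u k + c becomes a relation between the
  frequencies t and u t. For |w| = 1 it equates moduli along an orbit of units; for u = w = 1 it
  forces the transform to vanish wherever the phase is not 1.\<close>

lemma dft_affine:
  assumes q: "q > 0" and per: "\<And>k. f (k + q) = f k" and u: "coprime u q"
    and f: "\<And>k. f (u * k + c) = w * f k"
  shows "dft q f t = w * root_exp q (- (int c * int t)) * dft q f (u * t)"
proof -
  let ?g = "\<lambda>k. f k * root_exp q (- (int k * int t))"
  have "?g (k + q) = ?g k" for k
    using per root_exp_periodic[OF q, of "- (int k * int t)" "- int t"] by (simp add: algebra_simps)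
  then have "dft q f t = (\<Sum>k<q. ?g (u * k + c))"
    unfolding dft_def by (intro sum_periodic_affine[symmetric] u q)
  also have "\<dots> = (\<Sum>k<q. w * root_exp q (- (int c * int t)) * (f k * root_exp q (- (int k * int (u * t)))))"
  proof (intro sum.cong refl)
    fix k
    have "- (int (u * k + c) * int t) = - (int c * int t) + - (int k * int (u * t))"
      by (simp add: algebra_simps)
    then show "f (u * k + c) * root_exp q (- (int (u * k + c) * int t))
        = w * root_exp q (- (int c * int t)) * (f k * root_exp q (- (int k * int (u * t))))"
      by (simp only: f root_exp_add) (simp add: mult_ac)
  qed
  finally show ?thesis by (simp add: dft_def sum_distrib_left)
qed

lemma dft_eq_mod:
  assumes "q > 0"
  shows "dft q f (t mod q) = dft q f t"
proof -
  have "dft q f (t + q) = dft q f t" for t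
    unfolding dft_def
    using root_exp_periodic[OF assms, of "- (int k * int t)" "- int k" for k]
    by (intro sum.cong refl) (simp add: algebra_simps)
  then show ?thesis by (rule periodic_mod)
qed

section \<open>Multiplication of frequencies by units\<close>

lemma card_mult_cong_le:
  fixes q t s :: nat
  assumes "q > 0"
  shows "card {u. u < q \<and> (u * t) mod q = s} \<le> gcd t q"
proof (cases "{u. u < q \<and> (u * t) mod q = s} = {}")
  case False
  then obtain v where v: "v < q" "(v * t) mod q = s" by auto
  define g where "g = gcd t q"
  have g: "g > 0" using assms by (simp add: g_def)
  then obtain t' N where tN: "t = t' * g" "q = N * g" "coprime t' N"
    using gcd_coprime_exists[of t q] unfolding g_def by auto
  \<comment> \<open>With q = N g and t' coprime to N, two solutions agree modulo N, so the quotient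
    by N, which is below g, tells them apart.\<close>
  have "inj_on (\<lambda>u. u div N) {u. u < q \<and> (u * t) mod q = s}"
  proof (rule inj_onI)
    fix x y assume x: "x \<in> {u. u < q \<and> (u * t) mod q = s}" and y: "y \<in> {u. u < q \<and> (u * t) mod q = s}"
      and xy: "x div N = y div N"
    have "[t * x = t * y] (mod q)" using x y by (simp add: cong_def mult.commute)
    then have "[(t' * x) * g = (t' * y) * g] (mod N * g)"
      using tN(1,2) by (simp only: mult_ac)
    then have "[t' * x = t' * y] (mod N)"
      using g by (simp add: cong_def mod_mult_mult2)
    then have "[x = y] (mod N)" using tN(3) by (simp add: cong_mult_lcancel_nat)
    then show "x = y" using xy by (metis cong_def div_mult_mod_eq)
  qed
  then have "card {u. u < q \<and> (u * t) mod q = s} = card ((\<lambda>u. u div N) ` {u. u < q \<and> (u * t) mod q = s})"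
    by (simp add: card_image)
  also have "\<dots> \<le> card {..<g}"
  proof (rule card_mono)
    show "(\<lambda>u. u div N) ` {u. u < q \<and> (u * t) mod q = s} \<subseteq> {..<g}"
      using tN(2) by (auto simp: less_mult_imp_div_less mult.commute)
  qed simp
  finally show ?thesis by (simp add: g_def)
qed (metis card.empty zero_le)

text \<open>The units congruent to 1 modulo \<open>d\<close> form a subgroup, every nonempty fibre of reduction modulo
  \<open>d\<close> injects into it, and there are at most \<open>d\<close> fibres.\<close>
lemma totient_le_mult_card_units_cong_1:
  fixes q d :: nat
  assumes "q > 0" "d > 0" "d dvd q"
  shows "totient q \<le> d * card {u. u < q \<and> coprime u q \<and> [u = 1] (mod d)}"
proof -
  define G where "G = {u. u < q \<and> coprime u q \<and> [u = 1] (mod d)}"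
  define U where "U = {u. u < q \<and> coprime u q}"
  have fin: "finite U" "finite G" by (auto simp: U_def G_def)
  have fibre: "card {u \<in> U. u mod d = c} \<le> card G" for c
  proof (cases "{u \<in> U. u mod d = c} = {}")
    case False
    then obtain v where v: "v < q" "coprime v q" "v mod d = c" by (auto simp: U_def)
    then obtain w where w: "[v * w = 1] (mod q)" using cong_solve_coprime_nat by auto
    have cw: "coprime w q"
      using w by (metis cong_imp_coprime cong_sym coprime_1_left coprime_mult_left_iff)
    let ?h = "\<lambda>u. (u * w) mod q"
    have "inj_on ?h {u \<in> U. u mod d = c}"
    proof (rule inj_onI)
      fix x y assume "x \<in> {u \<in> U. u mod d = c}" "y \<in> {u \<in> U. u mod d = c}" "?h x = ?h y"
      then have "x < q" "y < q" "[x * w = y * w] (mod q)" by (auto simp: cong_def U_def)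
      then show "x = y" using cw by (metis cong_def cong_mult_rcancel_nat mod_less)
    qed
    then have "card {u \<in> U. u mod d = c} = card (?h ` {u \<in> U. u mod d = c})" by (simp add: card_image)
    also have "\<dots> \<le> card G"
    proof (rule card_mono[OF fin(2)], rule image_subsetI)
      fix u assume u: "u \<in> {u \<in> U. u mod d = c}"
      then have "[u = v] (mod d)" using v by (simp add: cong_def)
      then have "[u * w = v * w] (mod d)" by (rule cong_scalar_right)
      also have "[v * w = 1] (mod d)" using w assms(3) cong_dvd_modulus_nat by blast
      finally have "[u * w = 1] (mod d)" .
      then have "[?h u = 1] (mod d)" using assms(3) by (simp add: cong_def mod_mod_cancel)
      moreover have "coprime (?h u) q" using u cw by (simp add: U_def)
      ultimately show "?h u \<in> G" using assms(1) by (simp add: G_def)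
    qed
    finally show ?thesis .
  qed (metis card.empty zero_le)
  have "totient q = card U"
  \<comment> \<open>\<open>totatives q\<close> lives in {1..q} and \<open>U\<close> in {0..<q}; the
    two differ only for q = 1, where 0 stands in for 1.\<close>
  proof (cases "q = 1")
    case True
    have "U = {0}" using True by (auto simp: U_def)
    then show ?thesis using True by simp
  next
    case False
    then have "U = totatives q"
      using assms(1) by (auto simp: U_def totatives_def le_less intro!: Nat.gr0I)
    then show ?thesis by (simp add: totient_def)
  qed
  also have "\<dots> = (\<Sum>u\<in>U. 1)" by simp
  also have "\<dots> = (\<Sum>c<d. \<Sum>u | u \<in> U \<and> u mod d = c. 1)"
    using assms(2) fin by (intro sum.group[symmetric]) auto
  also have "\<dots> = (\<Sum>c<d. card {u \<in> U. u mod d = c})" by simp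
  also have "\<dots> \<le> (\<Sum>c<d. card G)" by (intro sum_mono fibre)
  finally show ?thesis by (simp add: G_def)
qed

text \<open>Multiplication by v maps the progression b + k l into itself once v = 1 + l j, since
  then v (b + k l) = b + (v k + b j) l. The character sees v only modulo q, and the congruences v =
  u modulo q and v = 1 modulo l are compatible because u = 1 modulo gcd l q.\<close>

lemma dirichlet_character_ap_affine:
  fixes b l u q :: nat
  assumes chi: "dirichlet_character q chi" and l: "l > 0"
    and u: "[u = 1] (mod gcd l q)"
  obtains v c where "[v = u] (mod q)" "\<And>k. chi (b + (v * k + c) * l) = chi u * chi (b + k * l)"
proof -
  note D = dirichlet_characterD[OF chi]
  \<comment> \<open>The expression 1 + u (l - 1) stands for 1 - u modulo l, written without a
    truncating subtraction of u.\<close>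
  have "[1 + u * (l - 1) = 1 + 1 * (l - 1)] (mod gcd l q)"
    using u by (intro cong_add cong_mult cong_refl)
  then have "[1 + u * (l - 1) = l] (mod gcd l q)" using l by simp
  then have "gcd q l dvd 1 + u * (l - 1)"
    by (metis cong_dvd_iff gcd.commute gcd_dvd1)
  then obtain y where y: "[q * y = 1 + u * (l - 1)] (mod l)"
    using cong_solve_dvd_nat by blast
  \<comment> \<open>The summand q l changes neither congruence; it makes v positive, so that v - 1
    is a true difference.\<close>
  define v where "v = u + q * y + q * l"
  have v0: "v \<ge> 1" using l D(1) by (simp add: v_def Suc_le_eq)
  have vq: "[v = u] (mod q)" by (simp add: v_def cong_def)
  have "[v = u + (1 + u * (l - 1)) + 0] (mod l)"
    unfolding v_def using y by (intro cong_add cong_refl) (simp_all add: cong_def)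
  also have "u + (1 + u * (l - 1)) + 0 = 1 + u * l"
    using l by (cases l) auto
  also have "[1 + u * l = 1] (mod l)" unfolding cong_def by (rule mod_mult_self1)
  finally have "l dvd v - 1" using v0 by (simp add: cong_altdef_nat)
  then obtain j where j: "v = 1 + l * j" using v0 by (metis add_diff_inverse_nat dvdE not_less)
  have "chi (b + (v * k + b * j) * l) = chi u * chi (b + k * l)" for k
  proof -
    have "b + (v * k + b * j) * l = v * (b + k * l)" by (simp add: j algebra_simps)
    then have "chi (b + (v * k + b * j) * l) = chi v * chi (b + k * l)" by (simp only: D(3))
    also have "chi v = chi u" by (rule periodic_cong[of chi q, OF D(2) vq])
    finally show ?thesis .
  qed
  with vq show thesis by (rule that)
qed

text \<open>Of the two factors gcd t q, one is the multiplicity with which the orbit u t, u in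
  \<open>G\<close>, meets a frequency: Parseval gives |G| |f^(t)|^2 <= g q^2. The other comes from
  |G| >= totient q / d and d <= g, valid when d divides t; for other t the transform is
  zero.\<close>

lemma dft_dirichlet_character_ap_le:
  fixes b l q t :: nat
  assumes chi: "dirichlet_character q chi" and l: "l > 0" and t: "t > 0"
  defines "f \<equiv> \<lambda>k. chi (b + k * l)"
  shows "(norm (dft q f t))\<^sup>2 \<le> real q * real (card {d. d dvd q}) * (real (gcd t q))\<^sup>2"
proof -
  note D = dirichlet_characterD[OF chi]
  define d where "d = gcd l q"
  define G where "G = {u. u < q \<and> coprime u q \<and> [u = 1] (mod d)}"
  define g where "g = gcd t q"
  have q: "q > 0" by (rule D)
  have d: "d > 0" "d dvd q" "d dvd l" using q by (auto simp: d_def)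
  have g: "g > 0" using q by (simp add: g_def)
  have per: "f (k + q) = f k" for k
    unfolding f_def using periodic_add_mult[of chi q, OF D(2), of "b + k * l" l] by (simp add: algebra_simps)
  have finG: "finite G" by (simp add: G_def)
  show ?thesis
  proof (cases "d dvd t")
    case False
    \<comment> \<open>A step of q/d along the progression moves the argument by a multiple of q, so
      \<open>f\<close> has period \<open>c\<close>. A frequency then survives only if q divides c t,
      that is, if d divides t.\<close>
    define c where "c = q div d"
    have cd: "q = c * d" using d by (simp add: c_def)
    have "f (1 * k + c) = 1 * f k" for k
    proof -
      have "q dvd c * l" using d(3) by (simp add: cd)
      then obtain j where "c * l = q * j" by auto
      then show ?thesis
        using periodic_add_mult[of chi q, OF D(2), of "b + k * l" j]
        by (simp add: f_def algebra_simps)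
    qed
    from dft_affine[OF q per _ this, of t]
    have "dft q f t = root_exp q (- (int c * int t)) * dft q f t" by simp
    moreover have "root_exp q (- (int c * int t)) \<noteq> 1"
    proof
      assume "root_exp q (- (int c * int t)) = 1"
      then have "q dvd c * t" using q by (simp add: root_exp_eq_1_iff flip: of_nat_mult)
      then show False using False q by (simp add: cd)
    qed
    ultimately have "dft q f t = 0" by (metis mult_cancel_right1)
    then show ?thesis by simp
  next
    case True
    have norm_eq: "norm (dft q f ((u * t) mod q)) = norm (dft q f t)" if "u \<in> G" for u
    proof -
      have u: "coprime u q" "[u = 1] (mod gcd l q)" using that by (auto simp: G_def d_def)
      obtain v c where v: "[v = u] (mod q)" "\<And>k. chi (b + (v * k + c) * l) = chi u * chi (b + k * l)"
        using dirichlet_character_ap_affine[OF chi l u(2)] by blast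
      have "coprime v q" using u(1) v(1) by (metis cong_imp_coprime cong_sym)
      then have "dft q f t = chi u * root_exp q (- (int c * int t)) * dft q f (v * t)"
        using v(2) by (intro dft_affine q per) (auto simp: f_def)
      then have "norm (dft q f t) = norm (dft q f (v * t))"
        using norm_dirichlet_character[OF chi u(1)] by (simp add: norm_mult)
      also have "dft q f (v * t) = dft q f ((v * t) mod q)" by (simp add: dft_eq_mod[OF q])
      also have "(v * t) mod q = (u * t) mod q"
        using v(1) by (metis cong_def cong_scalar_right)
      finally show ?thesis by simp
    qed
    \<comment> \<open>The constant modulus is summed over \<open>G\<close> and sorted by the residue
      of u t, so that Parseval applies with multiplicity at most \<open>g\<close>.\<close>
    have "real (card G) * (norm (dft q f t))\<^sup>2 = (\<Sum>u\<in>G. (norm (dft q f ((u * t) mod q)))\<^sup>2)"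
      by (simp add: norm_eq)
    also have "\<dots> = (\<Sum>s<q. \<Sum>u | u \<in> G \<and> (u * t) mod q = s. (norm (dft q f ((u * t) mod q)))\<^sup>2)"
      using finG q by (intro sum.group[symmetric]) auto
    also have "\<dots> = (\<Sum>s<q. real (card {u \<in> G. (u * t) mod q = s}) * (norm (dft q f s))\<^sup>2)"
      by (intro sum.cong refl) simp
    also have "\<dots> \<le> (\<Sum>s<q. real g * (norm (dft q f s))\<^sup>2)"
    proof (intro sum_mono mult_right_mono)
      fix s
      have "card {u \<in> G. (u * t) mod q = s} \<le> card {u. u < q \<and> (u * t) mod q = s}"
        by (intro card_mono) (auto simp: G_def)
      also have "\<dots> \<le> g" unfolding g_def by (rule card_mult_cong_le[OF q])
      finally show "real (card {u \<in> G. (u * t) mod q = s}) \<le> real g" by simp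
    qed auto
    also have "\<dots> = real g * (real q * (\<Sum>k<q. (norm (f k))\<^sup>2))"
      by (simp add: dft_parseval[OF q] flip: sum_distrib_left)
    also have "(\<Sum>k<q. (norm (f k))\<^sup>2) \<le> (\<Sum>k<q. 1)"
      unfolding f_def using norm_dirichlet_character_le[OF chi]
      by (intro sum_mono) (simp add: power_le_one)
    finally have 1: "real (card G) * (norm (dft q f t))\<^sup>2 \<le> real g * (real q * real q)"
      using g q by simp
    have "q \<le> totient q * card {d. d dvd q}" by (rule le_totient_mult_card_divisors[OF q])
    also have "\<dots> \<le> (d * card G) * card {d. d dvd q}"
      unfolding G_def by (intro mult_right_mono totient_le_mult_card_units_cong_1 q d) auto
    also have "\<dots> \<le> (g * card G) * card {d. d dvd q}"
      using True d t unfolding g_def by (intro mult_le_mono dvd_imp_le le_refl) auto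
    finally have "real q \<le> real ((g * card G) * card {d. d dvd q})" by (rule of_nat_mono)
    then have 2: "real q \<le> real g * real (card G) * real (card {d. d dvd q})" by simp
    then have "card G > 0" using q by (intro Nat.gr0I) auto
    have "real q * (norm (dft q f t))\<^sup>2 \<le> real g * real (card G) * real (card {d. d dvd q}) * (norm (dft q f t))\<^sup>2"
      using 2 by (intro mult_right_mono) auto
    also have "\<dots> = real g * real (card {d. d dvd q}) * (real (card G) * (norm (dft q f t))\<^sup>2)" by simp
    also have "\<dots> \<le> real g * real (card {d. d dvd q}) * (real g * (real q * real q))"
      using 1 by (intro mult_left_mono) auto
    also have "\<dots> = real q * (real q * real (card {d. d dvd q}) * (real g)\<^sup>2)"
      by (simp add: power2_eq_square)
    finally show ?thesis using q by (simp add: g_def)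
  qed
qed

text \<open>Completion: inversion gives a sum over frequencies of transform times geometric sum.
  Frequency 0 would grow linearly in n; it is the mean of \<open>f\<close> and is subtracted. The
  weight gcd t q is invariant under t -> q - t, so both reciprocals in the geometric bound
  contribute equally.\<close>

lemma incomplete_sum_dft_le:
  fixes f :: "nat \<Rightarrow> complex" and M :: real
  assumes q: "q > 0" and per: "\<And>k. f (k + q) = f k"
    and M: "\<And>t. 0 < t \<Longrightarrow> t < q \<Longrightarrow> norm (dft q f t) \<le> M * real (gcd t q)" "M \<ge> 0"
  shows "norm (\<Sum>k<n. f k - dft q f 0 / of_nat q) \<le> M * (real (card {d. d dvd q}) * (1 + ln (real q)))"
proof -
  have f: "f k - dft q f 0 / of_nat q = (\<Sum>t\<in>{1..<q}. dft q f t * root_exp q (int t * int k)) / of_nat q" for k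
  proof -
    have "f k = f (k mod q)" using periodic_mod[of f q k] per by simp
    also have "\<dots> = (\<Sum>t<q. dft q f t * root_exp q (int t * int (k mod q))) / of_nat q"
      using q by (intro dft_inversion) simp
    also have "(\<Sum>t<q. dft q f t * root_exp q (int t * int (k mod q))) = (\<Sum>t<q. dft q f t * root_exp q (int t * int k))"
    proof (intro sum.cong refl)
      fix t
      have "int t * int k = int t * int (k mod q) + int q * (int t * int (k div q))"
        by (metis (no_types) add.commute distrib_left mult.assoc mult.commute mult_div_mod_eq of_nat_add of_nat_mult)
      then show "dft q f t * root_exp q (int t * int (k mod q)) = dft q f t * root_exp q (int t * int k)"
        using root_exp_periodic[OF q] by simp
    qed
    also have "{..<q} = insert 0 {1..<q}" using q by auto
    finally show ?thesis by (simp add: add_divide_distrib)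
  qed
  have "(\<Sum>k<n. f k - dft q f 0 / of_nat q)
      = (\<Sum>t\<in>{1..<q}. dft q f t * (\<Sum>k<n. root_exp q (int t * int k))) / of_nat q"
    unfolding f sum_divide_distrib[symmetric] by (subst sum.swap) (simp add: sum_distrib_left)
  then have "norm (\<Sum>k<n. f k - dft q f 0 / of_nat q)
      = norm (\<Sum>t\<in>{1..<q}. dft q f t * (\<Sum>k<n. root_exp q (int t * int k))) / real q"
    by (simp add: norm_divide)
  also have "norm (\<Sum>t\<in>{1..<q}. dft q f t * (\<Sum>k<n. root_exp q (int t * int k)))
      \<le> (\<Sum>t\<in>{1..<q}. (M * real (gcd t q)) * (real q / 2 * (1 / real t + 1 / real (q - t))))"
  proof (intro sum_norm_le)
    fix t assume "t \<in> {1..<q}"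
    then have t: "0 < t" "t < q" by auto
    show "norm (dft q f t * (\<Sum>k<n. root_exp q (int t * int k)))
        \<le> (M * real (gcd t q)) * (real q / 2 * (1 / real t + 1 / real (q - t)))"
      unfolding norm_mult using M(2) by (intro mult_mono M(1) norm_sum_root_exp_le t) auto
  qed
  also have "\<dots> = M * real q / 2 * ((\<Sum>t\<in>{1..<q}. real (gcd t q) / real t) + (\<Sum>t\<in>{1..<q}. real (gcd t q) / real (q - t)))"
    by (simp add: sum_distrib_left sum.distrib[symmetric] algebra_simps)
  also have "(\<Sum>t\<in>{1..<q}. real (gcd t q) / real (q - t)) = (\<Sum>t\<in>{1..<q}. real (gcd t q) / real t)"
  proof (rule sum.reindex_bij_witness[of _ "\<lambda>t. q - t" "\<lambda>t. q - t"])
    fix t assume "t \<in> {1..<q}"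
    then have "gcd (q - t) q = gcd t q" by (metis atLeastLessThan_iff gcd.commute gcd_diff2_nat less_imp_le)
    then show "real (gcd (q - t) q) / real (q - t) = real (gcd t q) / real (q - t)" by simp
  qed auto
  finally have "norm (\<Sum>k<n. f k - dft q f 0 / of_nat q)
      \<le> M * (\<Sum>t\<in>{1..<q}. real (gcd t q) / real t)"
    using q by (simp add: field_simps)
  also have "\<dots> \<le> M * (real (card {d. d dvd q}) * (1 + ln (real q)))"
    using M(2) by (intro mult_left_mono sum_gcd_div_le q)
  finally show ?thesis .
qed

text \<open>The centre \<open>\<mu>\<close> is the mean over a period and may be nonzero: if q
  divides l and b is coprime to q, the coefficients are constantly chi b.\<close>

lemma polya_vinogradov_ap:
  fixes \<epsilon> :: real
  assumes "\<epsilon> > 0"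
  shows "\<exists>C\<ge>1. \<forall>q chi b l. dirichlet_character q chi \<longrightarrow> l > 0 \<longrightarrow>
    (\<exists>\<mu>. norm \<mu> \<le> 1 \<and> (\<forall>n. norm (\<Sum>k<n. chi (b + k * l) - \<mu>) \<le> C * real q powr (1/2 + \<epsilon>)))"
proof -
  \<comment> \<open>There are three losses of q^\<delta>: the divisor count inside \<open>M\<close>,
    whose square root is bounded by the count itself; the divisor count from the sum of gcd t q / t;
    and the logarithm.\<close>
  define \<delta> where "\<delta> = \<epsilon> / 3"
  have \<delta>: "\<delta> > 0" using assms by (simp add: \<delta>_def)
  obtain K where K: "K \<ge> 1" "\<And>n. n > 0 \<Longrightarrow> real (card {d. d dvd n}) \<le> K * real n powr \<delta>"
    using card_divisors_bound[OF \<delta>] by blast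
  define C where "C = K * K * (1 + 1 / \<delta>)"
  have "1 * 1 \<le> K * K" using K by (intro mult_mono) auto
  then have "1 * 1 \<le> C" unfolding C_def using \<delta> by (intro mult_mono) auto
  moreover have "\<exists>\<mu>. norm \<mu> \<le> 1 \<and> (\<forall>n. norm (\<Sum>k<n. chi (b + k * l) - \<mu>) \<le> C * real q powr (1/2 + \<epsilon>))"
    if chi: "dirichlet_character q chi" and l: "l > 0" for q chi and b l :: nat
  proof -
    note D = dirichlet_characterD[OF chi]
    define f where "f = (\<lambda>k. chi (b + k * l))"
    have q: "q > 0" by (rule D)
    have per: "f (k + q) = f k" for k
      unfolding f_def using periodic_add_mult[of chi q, OF D(2), of "b + k * l" l] by (simp add: algebra_simps)
    define M where "M = sqrt (real q * real (card {d. d dvd q}))"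
    have dft: "norm (dft q f t) \<le> M * real (gcd t q)" if "0 < t" for t
    proof -
      have "(norm (dft q f t))\<^sup>2 \<le> (M * real (gcd t q))\<^sup>2"
        using dft_dirichlet_character_ap_le[OF chi l that, of b]
        by (simp add: f_def M_def power_mult_distrib)
      then show ?thesis by (rule power2_le_imp_le) (simp add: M_def)
    qed
    have q1: "real q \<ge> 1" using q by simp
    have card1: "real (card {d. d dvd q}) \<ge> 1"
    proof -
      have "card {1::nat} \<le> card {d. d dvd q}" using q by (intro card_mono) auto
      then show ?thesis by simp
    qed
    have "M \<le> real q powr (1/2) * (K * real q powr \<delta>)"
    proof -
      have "sqrt (real (card {d. d dvd q})) \<le> real (card {d. d dvd q})"
        using card1 by (intro real_le_lsqrt) (auto simp: power2_eq_square mult_le_cancel_left1)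
      also have "\<dots> \<le> K * real q powr \<delta>" by (rule K(2)[OF q])
      finally show ?thesis by (simp add: M_def real_sqrt_mult powr_half_sqrt mult_left_mono)
    qed
    moreover have "1 + ln (real q) \<le> (1 + 1 / \<delta>) * real q powr \<delta>"
    proof -
      have "ln (real q) \<le> real q powr \<delta> / \<delta>" using q1 \<delta> by (rule ln_powr_bound)
      moreover have "1 \<le> real q powr \<delta>" using q1 \<delta> by (simp add: ge_one_powr_ge_zero)
      ultimately show ?thesis by (simp add: algebra_simps)
    qed
    ultimately have "M * (real (card {d. d dvd q}) * (1 + ln (real q)))
        \<le> (real q powr (1/2) * (K * real q powr \<delta>)) * ((K * real q powr \<delta>) * ((1 + 1 / \<delta>) * real q powr \<delta>))"
      using K(1) K(2)[OF q] q1 by (intro mult_mono) (auto simp: M_def)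
    also have "\<dots> = C * real q powr (1/2 + \<epsilon>)"
    proof -
      have "1/2 + \<epsilon> = 1/2 + \<delta> + \<delta> + \<delta>" by (simp add: \<delta>_def)
      then have "real q powr (1/2 + \<epsilon>) = real q powr (1/2) * real q powr \<delta> * real q powr \<delta> * real q powr \<delta>"
        by (simp only: powr_add)
      then show ?thesis by (simp add: C_def)
    qed
    finally have bound: "M * (real (card {d. d dvd q}) * (1 + ln (real q))) \<le> C * real q powr (1/2 + \<epsilon>)" .
    have "norm (dft q f 0 / of_nat q) \<le> 1"
    proof -
      have "norm (dft q f 0) \<le> (\<Sum>k<q. 1)"
        unfolding dft_def f_def
        by (intro sum_norm_le) (simp add: norm_dirichlet_character_le[OF chi])
      then show ?thesis using q by (simp add: norm_divide)
    qed
    moreover have "norm (\<Sum>k<n. f k - dft q f 0 / of_nat q) \<le> C * real q powr (1/2 + \<epsilon>)" for n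
      using incomplete_sum_dft_le[OF q per dft, of n] bound by (auto simp: M_def intro: order_trans)
    ultimately show ?thesis by (auto simp: f_def)
  qed
  ultimately show ?thesis by auto
qed

section \<open>Meromorphic continuation of series with periodic coefficients\<close>

lemma summable_shifted_powr:
  fixes a p :: real
  assumes "a \<ge> 1" "p < -1"
  shows "summable (\<lambda>n. (real n + a) powr p)"
proof (rule summable_comparison_test')
  show "summable (\<lambda>n. real (Suc n) powr p)"
    using assms(2) by (subst summable_Suc_iff) (simp add: summable_real_powr_iff)
  show "norm ((real n + a) powr p) \<le> real (Suc n) powr p" for n
    using assms by (auto intro: powr_mono2')
qed

text \<open>The M-test on small discs. The constant may depend on the radius \<open>R\<close>
  because the coefficients of the binomial expansions to which this is applied grow with the norm of
  z.\<close>

lemma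
  fixes h :: "nat \<Rightarrow> complex \<Rightarrow> complex" and a \<sigma> :: real
  assumes S: "open S" "S \<subseteq> {s. \<sigma> < Re s}" and a: "a \<ge> 1"
    and hol: "\<And>n. h n holomorphic_on S"
    and bound: "\<And>R. \<exists>C. \<forall>n. \<forall>z\<in>S. norm z \<le> R \<longrightarrow> norm (h n z) \<le> C * (real n + a) powr (\<sigma> - 1 - Re z)"
  shows summable_halfplane_series: "\<And>s. s \<in> S \<Longrightarrow> summable (\<lambda>n. norm (h n s))"
    and holomorphic_on_halfplane_series: "(\<lambda>s. \<Sum>n. h n s) holomorphic_on S"
proof -
  show "summable (\<lambda>n. norm (h n s))" if s: "s \<in> S" for s
  proof -
    obtain C where C: "\<And>n. norm (h n s) \<le> C * (real n + a) powr (\<sigma> - 1 - Re s)"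
      using bound[of "norm s"] s by blast
    show ?thesis
    proof (rule summable_comparison_test')
      show "summable (\<lambda>n. C * (real n + a) powr (\<sigma> - 1 - Re s))"
        using S s a by (intro summable_mult summable_shifted_powr) auto
    qed (use C in simp)
  qed
  show "(\<lambda>s. \<Sum>n. h n s) holomorphic_on S"
  proof (rule holomorphic_uniform_sequence[OF S(1)])
    show "(\<lambda>s. \<Sum>i<n. h i s) holomorphic_on S" for n
      by (intro holomorphic_intros hol)
  next
    fix s assume s: "s \<in> S"
    then obtain e where e: "e > 0" "cball s e \<subseteq> S" using S(1) open_contains_cball by blast
    \<comment> \<open>Half the distance to the boundary line: on a disc of radius at most
      \<open>\<eta>\<close> the exponent is at most -1 - \<open>\<eta>\<close>.\<close>
    define \<eta> where "\<eta> = (Re s - \<sigma>) / 2"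
    define d where "d = min e \<eta>"
    have \<eta>: "\<eta> > 0" using S s by (auto simp: \<eta>_def)
    have d: "d > 0" using e \<eta> by (simp add: d_def)
    have sub: "cball s d \<subseteq> S" using e by (auto simp: d_def)
    obtain C where C: "\<And>n z. z \<in> S \<Longrightarrow> norm z \<le> norm s + d \<Longrightarrow> norm (h n z) \<le> C * (real n + a) powr (\<sigma> - 1 - Re z)"
      using bound[of "norm s + d"] by blast
    have "uniform_limit (cball s d) (\<lambda>n x. \<Sum>i<n. h i x) (\<lambda>x. \<Sum>i. h i x) sequentially"
    proof (rule Weierstrass_m_test)
      show "summable (\<lambda>n. \<bar>C\<bar> * (real n + a) powr (- 1 - \<eta>))"
        using a \<eta> by (intro summable_mult summable_shifted_powr) auto
      fix n x assume x: "x \<in> cball s d"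
      have "norm x \<le> norm s + d"
        using x norm_triangle_sub[of x s] by (simp add: dist_norm norm_minus_commute)
      then have "norm (h n x) \<le> C * (real n + a) powr (\<sigma> - 1 - Re x)"
        using x sub by (intro C) auto
      also have "\<dots> \<le> \<bar>C\<bar> * (real n + a) powr (\<sigma> - 1 - Re x)"
        by (intro mult_right_mono) auto
      also have "\<dots> \<le> \<bar>C\<bar> * (real n + a) powr (- 1 - \<eta>)"
      proof (intro mult_left_mono powr_mono)
        have "\<bar>Re (s - x)\<bar> \<le> norm (s - x)" by (rule abs_Re_le_cmod)
        also have "\<dots> \<le> \<eta>" using x by (simp add: dist_norm d_def)
        finally have "Re s - Re x \<le> \<eta>" by (simp add: abs_le_iff)
        moreover have "Re s - \<sigma> = 2 * \<eta>" by (simp add: \<eta>_def)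
        ultimately show "\<sigma> - 1 - Re x \<le> - 1 - \<eta>" by linarith
      qed (use a in auto)
      finally show "norm (h n x) \<le> \<bar>C\<bar> * (real n + a) powr (- 1 - \<eta>)" .
    qed
    with d sub show "\<exists>d. 0 < d \<and> cball s d \<subseteq> S \<and>
        uniform_limit (cball s d) (\<lambda>n x. \<Sum>i<n. h i x) (\<lambda>x. \<Sum>i. h i x) sequentially" by blast
  qed
qed

section \<open>Binomial remainders and the Hurwitz zeta function\<close>

lemma norm_gbinomial_le:
  fixes w :: complex
  assumes "norm w \<le> real K"
  shows "norm (w gchoose j) \<le> 2 ^ (K + j)"
proof -
  have "norm (w gchoose j) \<le> real ((K + j) choose j)"
  proof (induction j)
    case (Suc j)
    have "(w - of_nat j) * (w gchoose j) = of_nat (Suc j) * (w gchoose Suc j)"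
      using gbinomial_mult_1[of w j] by (simp add: algebra_simps)
    then have "real (Suc j) * norm (w gchoose Suc j) = norm (w - of_nat j) * norm (w gchoose j)"
      by (metis norm_mult norm_of_nat)
    also have "\<dots> \<le> (real K + real j) * real ((K + j) choose j)"
    proof (intro mult_mono Suc)
      show "norm (w - of_nat j) \<le> real K + real j"
        using norm_triangle_ineq4[of w "of_nat j"] assms by simp
    qed auto
    also have "\<dots> \<le> real (Suc (K + j)) * real ((K + j) choose j)" by (intro mult_right_mono) auto
    also have "\<dots> = real (Suc j) * real (Suc (K + j) choose Suc j)"
      using Suc_times_binomial_eq[of "K + j" j] by (metis mult.commute of_nat_mult)
    finally show ?case by simp
  qed simp
  also have "\<dots> \<le> real (2 ^ (K + j))" by (intro of_nat_mono binomial_le_pow2)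
  finally show ?thesis by simp
qed

text \<open>Coefficients of size 2^(K+j) against y <= 1/4 give majorants that at least halve at each
  step, so the tail is at most twice the majorant of its first term. This is why the continuation
  starts with a >= 4, where y = 1/x and x >= a.\<close>

lemma binomial_remainder_le:
  fixes w :: complex and y :: real
  assumes w: "norm w \<le> real K" and y: "0 \<le> y" "y \<le> 1 / 4"
  shows "norm ((1 + of_real y) powr w - (\<Sum>j<n. (w gchoose j) * of_real y ^ j)) \<le> 2 ^ (K + n + 1) * y ^ n"
proof (rule norm_sums_le)
  show "(\<lambda>i. (w gchoose (i + n)) * of_real y ^ (i + n)) sums
      ((1 + of_real y) powr w - (\<Sum>j<n. (w gchoose j) * of_real y ^ j))"
    using y by (intro sums_split_initial_segment gen_binomial_complex) auto
  have "(\<lambda>i. 2 ^ (K + n) * y ^ n * (1 / 2) ^ i) sums (2 ^ (K + n) * y ^ n * (1 / (1 - 1 / 2)))"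
    by (intro sums_mult geometric_sums) auto
  then show "(\<lambda>i. 2 ^ (K + n) * y ^ n * (1 / 2) ^ i) sums (2 ^ (K + n + 1) * y ^ n)"
    by (simp add: mult_ac)
  fix i
  have "norm ((w gchoose (i + n)) * of_real y ^ (i + n)) \<le> 2 ^ (K + (i + n)) * y ^ (i + n)"
    unfolding norm_mult using y
    by (intro mult_mono norm_gbinomial_le w) (auto simp: norm_power)
  also have "\<dots> = 2 ^ (K + n) * y ^ n * (2 * y) ^ i" by (simp add: power_add power_mult_distrib)
  also have "\<dots> \<le> 2 ^ (K + n) * y ^ n * (1 / 2) ^ i"
    using y by (intro mult_left_mono power_mono) auto
  finally show "norm ((w gchoose (i + n)) * of_real y ^ (i + n)) \<le> 2 ^ (K + n) * y ^ n * (1 / 2) ^ i" .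
qed

lemma norm_of_real_powr:
  assumes "x > 0"
  shows "norm (complex_of_real x powr s) = x powr Re s"
  using assms by (subst norm_powr_real_powr) auto

text \<open>With y = 1/x the expansion of (x + 1)^w = x^w (1 + y)^w has leading term x^w, which the
  difference cancels; removing the next n terms leaves a remainder n + 1 powers of x below
  x^w.\<close>

lemma norm_hurwitz_remainder_le:
  fixes x :: real and w :: complex
  assumes x: "x \<ge> 4" and w: "norm w \<le> real K"
  shows "norm (of_real x powr w - of_real (x + 1) powr w + (\<Sum>i<n. (w gchoose Suc i) * of_real x powr (w - of_nat (Suc i))))
    \<le> 2 ^ (K + n + 2) * x powr (Re w - real (Suc n))"
proof -
  define y where "y = 1 / x"
  have y: "0 \<le> y" "y \<le> 1 / 4" using x by (auto simp: y_def field_simps)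
  have x0: "complex_of_real x \<noteq> 0" using x by auto
  have "x + 1 = x * (1 + y)" using x by (simp add: y_def field_simps)
  then have "of_real (x + 1) powr w = (of_real x * of_real (1 + y)) powr w"
    by (simp only: of_real_mult)
  also have "\<dots> = of_real x powr w * (1 + of_real y) powr w"
    using x y by (subst powr_times_real) auto
  finally have 1: "of_real (x + 1) powr w = of_real x powr w * (1 + of_real y) powr w" .
  have 2: "of_real x powr (w - of_nat j) = of_real x powr w * of_real y ^ j" for j
    using x0 by (simp add: powr_diff powr_nat' y_def power_divide)
  have "of_real x powr w - of_real (x + 1) powr w + (\<Sum>i<n. (w gchoose Suc i) * of_real x powr (w - of_nat (Suc i)))
      = - (of_real x powr w * ((1 + of_real y) powr w - (\<Sum>j<Suc n. (w gchoose j) * of_real y ^ j)))"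
    unfolding 1 2 sum.lessThan_Suc_shift by (simp add: sum_distrib_left algebra_simps)
  then have "norm (of_real x powr w - of_real (x + 1) powr w + (\<Sum>i<n. (w gchoose Suc i) * of_real x powr (w - of_nat (Suc i))))
      = x powr Re w * norm ((1 + of_real y) powr w - (\<Sum>j<Suc n. (w gchoose j) * of_real y ^ j))"
    using x by (simp add: norm_mult norm_of_real_powr del: sum.lessThan_Suc)
  also have "\<dots> \<le> x powr Re w * (2 ^ (K + Suc n + 1) * y ^ Suc n)"
    by (intro mult_left_mono binomial_remainder_le w y) auto
  also have "\<dots> = 2 ^ (K + n + 2) * (x powr Re w * y ^ Suc n)" by simp
  also have "x powr Re w * y ^ Suc n = x powr (Re w - real (Suc n))"
    using x by (simp add: powr_diff powr_realpow y_def power_divide del: of_nat_Suc power_Suc)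
  finally show ?thesis .
qed

definition shifted_zeta_term :: "real \<Rightarrow> complex \<Rightarrow> nat \<Rightarrow> complex" where
  "shifted_zeta_term a s k = of_real (real k + a) powr (- s)"

lemma norm_shifted_zeta_term:
  assumes "a > 0"
  shows "norm (shifted_zeta_term a s k) = (real k + a) powr (- Re s)"
  unfolding shifted_zeta_term_def using assms by (subst norm_of_real_powr) (auto intro: add_nonneg_pos)

lemma holomorphic_shifted_zeta_term:
  assumes "a > 0"
  shows "(\<lambda>s. shifted_zeta_term a s k) holomorphic_on S"
proof -
  have "real k + a > 0" using assms by (simp add: add_nonneg_pos)
  then show ?thesis unfolding shifted_zeta_term_def by (intro holomorphic_intros)
qed

lemma summable_shifted_zeta_term:
  assumes "a \<ge> 1" "Re s > 1"
  shows "summable (\<lambda>k. norm (shifted_zeta_term a s k))"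
  using assms by (simp add: norm_shifted_zeta_term summable_shifted_powr)

lemma open_Re_gt: "open {s::complex. \<sigma> < Re s}"
  by (rule open_halfspace_Re_gt)

text \<open>Summing the binomial expansion of \<open>x\<^sup>1\<^sup>-\<^sup>s - (x + 1)\<^sup>1\<^sup>-\<^sup>s\<close> over \<open>x = k + a\<close> expresses
  \<open>Z s = (s - 1) \<zeta>(s, a)\<close> through \<open>Z (s + 1), Z (s + 2), \<dots>\<close> and a remainder that converges further to
  the left; each step extends \<open>Z\<close> by one unit.\<close>
lemma hurwitz_continuation_step:
  fixes a :: real and N :: nat
  assumes a: "a \<ge> 4"
  shows "\<exists>Z. Z holomorphic_on {s. 1 - real N < Re s} \<and>
    (\<forall>s. 1 < Re s \<longrightarrow> shifted_zeta_term a s sums (Z s / (s - 1)))"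
proof (induction N)
  case 0
  define Z where "Z = (\<lambda>s. (s - 1) * (\<Sum>k. shifted_zeta_term a s k))"
  have "(\<lambda>s. \<Sum>k. shifted_zeta_term a s k) holomorphic_on {s. 1 < Re s}"
  proof (rule holomorphic_on_halfplane_series[where a = a and \<sigma> = 1])
    show "\<exists>C. \<forall>n. \<forall>z\<in>{s. 1 < Re s}. norm z \<le> R \<longrightarrow>
        norm (shifted_zeta_term a z n) \<le> C * (real n + a) powr (1 - 1 - Re z)" for R
      using a by (intro exI[of _ 1]) (simp add: norm_shifted_zeta_term)
  qed (use a in \<open>auto intro: open_Re_gt holomorphic_shifted_zeta_term\<close>)
  then have "Z holomorphic_on {s. 1 < Re s}" unfolding Z_def by (intro holomorphic_intros)
  moreover have "shifted_zeta_term a s sums (Z s / (s - 1))" if "1 < Re s" for s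
  proof -
    have "summable (shifted_zeta_term a s)"
      using a that by (intro summable_norm_cancel[OF summable_shifted_zeta_term]) auto
    moreover have "s \<noteq> 1" using that by auto
    ultimately show ?thesis by (simp add: Z_def summable_sums)
  qed
  ultimately show ?case by auto
next
  case (Suc N)
  then obtain Z where Z: "Z holomorphic_on {s. 1 - real N < Re s}"
    "\<And>s. 1 < Re s \<Longrightarrow> shifted_zeta_term a s sums (Z s / (s - 1))" by blast
  let ?S = "{s::complex. - real N < Re s}"
  define X where "X = (\<lambda>k. real k + a)"
  have X: "X k \<ge> 4" for k using a by (simp add: X_def)
  have X_Suc: "X (Suc k) = X k + 1" for k by (simp add: X_def)
  \<comment> \<open>Removing N + 1 terms leaves decay with exponent -N - 1 - Re s, summable for Re s
    > -N.\<close>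
  define \<rho> where "\<rho> = (\<lambda>k (s::complex). of_real (X k) powr (1 - s) - of_real (X k + 1) powr (1 - s)
    + (\<Sum>i<Suc N. ((1 - s) gchoose Suc i) * of_real (X k) powr (1 - s - of_nat (Suc i))))"
  \<comment> \<open>For Re s > 1, summing \<open>\<rho>\<close> over k gives X_0^(1-s) plus the sum
    over i of binom(1-s, i+1) Z(s+i)/(s+i-1), whose term i = 0 is -Z(s); solved for Z(s), this is
    \<open>Z'\<close>. In the later terms the denominator cancels against a factor of the binomial
    coefficient, so no pole is left.\<close>
  define Z' where "Z' = (\<lambda>s. of_real (X 0) powr (1 - s)
    - (\<Sum>i<N. ((1 - s) gchoose Suc i) / of_nat (i + 2) * Z (s + of_nat (Suc i))) - (\<Sum>k. \<rho> k s))"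
  have hol_gb: "(\<lambda>s. (1 - s) gchoose i) holomorphic_on A" for i and A :: "complex set"
    unfolding gbinomial_prod_rev by (intro holomorphic_intros) auto
  have X_nz: "complex_of_real (X k) \<noteq> 0" "complex_of_real (X k + 1) \<noteq> 0" for k
    using X[of k] by (auto simp flip: of_real_add)
  have X_npos: "complex_of_real (X k) \<notin> \<real>\<^sub>\<le>\<^sub>0" "complex_of_real (X k + 1) \<notin> \<real>\<^sub>\<le>\<^sub>0" for k
    using X[of k] by (simp_all only: nonpos_Reals_of_real_iff)
  have \<rho>_bound: "\<exists>C. \<forall>n. \<forall>z\<in>?S. norm z \<le> R \<longrightarrow> norm (\<rho> n z) \<le> C * (real n + a) powr (- real N - 1 - Re z)" for R
  proof (intro exI allI ballI impI)
    fix n z assume z: "z \<in> ?S" "norm z \<le> R"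
    have "norm (1 - z) \<le> real (nat \<lceil>1 + R\<rceil>)"
      using norm_triangle_ineq4[of 1 z] z by (intro order_trans[OF _ real_nat_ceiling_ge]) simp
    note le = norm_hurwitz_remainder_le[OF X this, of n "Suc N"]
    have "Re (1 - z) - real (Suc (Suc N)) = - real N - 1 - Re z" by simp
    with le
    show "norm (\<rho> n z) \<le> 2 ^ (nat \<lceil>1 + R\<rceil> + Suc N + 2) * (real n + a) powr (- real N - 1 - Re z)"
      by (simp only: \<rho>_def X_def)
  qed
  have \<rho>_hol: "\<rho> k holomorphic_on ?S" for k
    unfolding \<rho>_def by (intro holomorphic_intros hol_gb X_npos)
  have \<rho>_sum: "(\<lambda>s. \<Sum>k. \<rho> k s) holomorphic_on ?S"
    by (rule holomorphic_on_halfplane_series[where a = a and \<sigma> = "- real N"])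
       (use a \<rho>_bound \<rho>_hol in \<open>auto intro: open_Re_gt\<close>)
  have Z_shift: "(\<lambda>s. Z (s + of_nat (Suc i))) holomorphic_on ?S" for i
  proof -
    have "Z \<circ> (\<lambda>s. s + of_nat (Suc i)) holomorphic_on ?S"
      by (rule holomorphic_on_compose_gen[OF _ Z(1)]) (auto intro!: holomorphic_intros)
    then show ?thesis by (simp add: o_def)
  qed
  have Z'_hol: "Z' holomorphic_on ?S"
    unfolding Z'_def by (intro holomorphic_intros hol_gb X_npos \<rho>_sum Z_shift) auto
  have Z'_eq: "Z' s = Z s" if s: "1 < Re s" for s
  proof -
    define w where "w = 1 - s"
    have w: "Re w < 0" using s by (simp add: w_def)
    have s0: "s + of_nat i \<noteq> 0" "s + of_nat i \<noteq> 1" for i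
      using s by (auto simp: complex_eq_iff)
    have "(\<lambda>k. of_real (X k) powr w) \<longlonglongrightarrow> 0"
    proof (rule tendsto_norm_zero_cancel)
      have "filterlim X at_top sequentially"
        unfolding X_def
        by (subst add.commute)
           (rule filterlim_tendsto_add_at_top[OF tendsto_const filterlim_real_sequentially])
      then have "(\<lambda>k. X k powr Re w) \<longlonglongrightarrow> 0" using w by (intro tendsto_neg_powr)
      moreover have "norm (of_real (X k) powr w) = X k powr Re w" for k
        using X[of k] by (intro norm_of_real_powr) auto
      ultimately show "(\<lambda>k. norm (of_real (X k) powr w)) \<longlonglongrightarrow> 0" by simp
    qed
    from telescope_sums'[OF this]
    have tel: "(\<lambda>k. of_real (X k) powr w - of_real (X k + 1) powr w) sums of_real (X 0) powr w"
      by (simp only: X_Suc diff_zero)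
    have tsum: "(\<lambda>k. (w gchoose Suc i) * of_real (X k) powr (w - of_nat (Suc i)))
        sums ((w gchoose Suc i) * (Z (s + of_nat i) / (s + of_nat i - 1)))" for i
    proof (rule sums_mult)
      have "of_real (X k) powr (w - of_nat (Suc i)) = shifted_zeta_term a (s + of_nat i) k" for k
        by (simp add: shifted_zeta_term_def X_def w_def algebra_simps)
      then show "(\<lambda>k. of_real (X k) powr (w - of_nat (Suc i))) sums (Z (s + of_nat i) / (s + of_nat i - 1))"
        using Z(2)[of "s + of_nat i"] s by simp
    qed
    have "(\<lambda>k. \<rho> k s) sums (of_real (X 0) powr w
        + (\<Sum>i<Suc N. (w gchoose Suc i) * (Z (s + of_nat i) / (s + of_nat i - 1))))"
      unfolding \<rho>_def w_def[symmetric] by (intro sums_add tel sums_sum tsum)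
    then have "(\<Sum>k. \<rho> k s) = of_real (X 0) powr w
        + (\<Sum>i<Suc N. (w gchoose Suc i) * (Z (s + of_nat i) / (s + of_nat i - 1)))"
      by (simp add: sums_iff)
    also have "\<dots> = of_real (X 0) powr w + (w * (Z s / (s - 1))
        + (\<Sum>i<N. (w gchoose Suc (Suc i)) * (Z (s + of_nat (Suc i)) / (s + of_nat (Suc i) - 1))))"
      by (subst sum.lessThan_Suc_shift) simp
    also have "w * (Z s / (s - 1)) = - Z s"
      using s0(2)[of 0] by (simp add: w_def field_simps)
    also have "(\<Sum>i<N. (w gchoose Suc (Suc i)) * (Z (s + of_nat (Suc i)) / (s + of_nat (Suc i) - 1)))
        = - (\<Sum>i<N. (w gchoose Suc i) / of_nat (i + 2) * Z (s + of_nat (Suc i)))"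
      unfolding sum_negf[symmetric]
    proof (intro sum.cong refl)
      fix i
      have "(w - of_nat (Suc i)) * (w gchoose Suc i) = of_nat (i + 2) * (w gchoose Suc (Suc i))"
        using gbinomial_mult_1[of w "Suc i"] by (simp add: algebra_simps)
      moreover have "w - of_nat (Suc i) = - (s + of_nat i)" by (simp add: w_def)
      ultimately have "w gchoose Suc (Suc i) = - ((s + of_nat i) * (w gchoose Suc i)) / of_nat (i + 2)"
        by (simp add: field_simps del: of_nat_add of_nat_Suc)
      moreover have "s + of_nat (Suc i) - 1 = s + of_nat i" by simp
      ultimately show "(w gchoose Suc (Suc i)) * (Z (s + of_nat (Suc i)) / (s + of_nat (Suc i) - 1))
          = - ((w gchoose Suc i) / of_nat (i + 2) * Z (s + of_nat (Suc i)))"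
        using s0(1)[of i] by simp
    qed
    finally show ?thesis by (simp add: Z'_def w_def[symmetric])
  qed
  show ?case
  proof (intro exI[of _ Z'] conjI allI impI)
    show "Z' holomorphic_on {s. 1 - real (Suc N) < Re s}" using Z'_hol by simp
    show "shifted_zeta_term a s sums (Z' s / (s - 1))" if "1 < Re s" for s
      using Z(2)[OF that] Z'_eq[OF that] by simp
  qed
qed

text \<open>Continuations to nested half planes agree by the identity theorem, so the value at s may
  be read off from any half plane containing s, and the glued function is locally one of
  them.\<close>

lemma hurwitz_continuation_ge_4:
  fixes a :: real
  assumes a: "a \<ge> 4"
  shows "\<exists>Z. Z holomorphic_on UNIV \<and>
    (\<forall>s. 1 < Re s \<longrightarrow> shifted_zeta_term a s sums (Z s / (s - 1)))"
proof -
  let ?H = "\<lambda>N::nat. {s::complex. 1 - real N < Re s}"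
  obtain Z where Z: "\<And>N. Z N holomorphic_on ?H N"
    "\<And>N s. 1 < Re s \<Longrightarrow> shifted_zeta_term a s sums (Z N s / (s - 1))"
    using hurwitz_continuation_step[OF a] by metis
  have eq: "Z M s = Z N s" if "M \<le> N" "s \<in> ?H M" for M N s
  proof (rule analytic_continuation_open[where s = "{s. 1 < Re s}" and s' = "?H M" and f = "Z M" and g = "Z N"])
    show "{s::complex. 1 < Re s} \<noteq> {}" by (auto intro: exI[of _ 2])
    show "connected (?H M)" by (intro convex_connected convex_halfspace_Re_gt)
    show "Z N holomorphic_on ?H M" by (rule holomorphic_on_subset[OF Z(1)]) (use that in auto)
    show "Z M z = Z N z" if "z \<in> {s. 1 < Re s}" for z
    proof -
      have "Z M z / (z - 1) = Z N z / (z - 1)" using that Z(2) sums_unique2 by blast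
      moreover have "z \<noteq> 1" using that by auto
      ultimately show ?thesis by simp
    qed
  qed (use that Z(1) in \<open>auto intro: open_Re_gt\<close>)
  define n where "n = (\<lambda>s::complex. nat \<lceil>\<bar>Re s\<bar>\<rceil> + 2)"
  have n: "s \<in> ?H (n s)" for s
  proof -
    have "\<bar>Re s\<bar> \<le> real (nat \<lceil>\<bar>Re s\<bar>\<rceil>)" by (rule real_nat_ceiling_ge)
    moreover have "real (n s) = real (nat \<lceil>\<bar>Re s\<bar>\<rceil>) + 2" by (simp add: n_def)
    ultimately have "1 - real (n s) < Re s" by linarith
    then show ?thesis by simp
  qed
  define Z0 where "Z0 = (\<lambda>s. Z (n s) s)"
  have Z0: "Z0 s = Z N s" if "s \<in> ?H N" for N s
  proof (cases "N \<le> n s")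
    case True
    show ?thesis unfolding Z0_def by (rule eq[OF True that, symmetric])
  next
    case False
    then have "n s \<le> N" by simp
    from eq[OF this n] show ?thesis unfolding Z0_def .
  qed
  have "\<exists>f'. (Z0 has_field_derivative f') (at s)" for s
  proof -
    have op: "open (?H (n s))" by (rule open_Re_gt)
    then obtain f' where "(Z (n s) has_field_derivative f') (at s)"
      using Z(1)[of "n s"] n[of s] by (auto simp: holomorphic_on_open)
    then have "(Z0 has_field_derivative f') (at s)"
      by (rule has_field_derivative_transform_within_open[OF _ op n]) (simp add: Z0)
    then show ?thesis by blast
  qed
  then have "Z0 holomorphic_on UNIV" by (simp add: holomorphic_on_open)
  moreover have "shifted_zeta_term a s sums (Z0 s / (s - 1))" if "1 < Re s" for s
    using Z(2)[OF that, of 0] Z0[of s 0] that by simp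
  ultimately show ?thesis by blast
qed

text \<open>The first four terms are entire in s; leaving them out moves the parameter to a + 4,
  where the binomial remainders converge. Small parameters do occur, namely (j + a)/q for periodic
  coefficients.\<close>

lemma hurwitz_continuation:
  fixes a :: real
  assumes a: "a > 0"
  shows "\<exists>g. g holomorphic_on - {1} \<and> (\<forall>s. 1 < Re s \<longrightarrow> shifted_zeta_term a s sums g s)"
proof -
  obtain Z where Z: "Z holomorphic_on UNIV"
    "\<And>s. 1 < Re s \<Longrightarrow> shifted_zeta_term (a + 4) s sums (Z s / (s - 1))"
    using hurwitz_continuation_ge_4[of "a + 4"] a by auto
  define g where "g = (\<lambda>s. Z s / (s - 1) + (\<Sum>k<4. shifted_zeta_term a s k))"
  have "g holomorphic_on - {1}"
    unfolding g_def using holomorphic_on_subset[OF Z(1)]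
    by (intro holomorphic_intros holomorphic_shifted_zeta_term a) auto
  moreover have "shifted_zeta_term a s sums g s" if "1 < Re s" for s
  proof -
    have "shifted_zeta_term (a + 4) s = (\<lambda>k. shifted_zeta_term a s (k + 4))"
      by (simp add: shifted_zeta_term_def fun_eq_iff add_ac)
    with Z(2)[OF that] show ?thesis by (simp add: g_def sums_iff_shift)
  qed
  ultimately show ?thesis by blast
qed

text \<open>Splitting k = i q + j gives k + a = q (i + (j + a)/q), so the series is a finite
  combination of q^(-s) zeta(s, (j + a)/q). Only existence of the continuation is drawn from this;
  its size comes from another representation.\<close>

lemma periodic_series_continuation:
  fixes f :: "nat \<Rightarrow> complex" and a :: real
  assumes a: "a \<ge> 1" and q: "q > 0" and per: "\<And>k. f (k + q) = f k"
    and bound: "\<And>k. norm (f k) \<le> 1"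
  shows "\<exists>g. g holomorphic_on - {1} \<and> (\<forall>s. 1 < Re s \<longrightarrow> (\<lambda>k. f k * shifted_zeta_term a s k) sums g s)"
proof -
  have "\<exists>g. g holomorphic_on - {1} \<and> (\<forall>s. 1 < Re s \<longrightarrow> shifted_zeta_term ((real j + a) / real q) s sums g s)" for j
    using a q by (intro hurwitz_continuation) auto
  then obtain G where G: "\<And>j. G j holomorphic_on - {1}"
    "\<And>j s. 1 < Re s \<Longrightarrow> shifted_zeta_term ((real j + a) / real q) s sums G j s" by metis
  define g where "g = (\<lambda>s. \<Sum>j<q. f j * of_real (real q) powr (- s) * G j s)"
  have "complex_of_real (real q) \<notin> \<real>\<^sub>\<le>\<^sub>0" using q by (simp only: nonpos_Reals_of_real_iff)
  then have "g holomorphic_on - {1}"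
    unfolding g_def by (intro holomorphic_intros G(1))
  moreover have "(\<lambda>k. f k * shifted_zeta_term a s k) sums g s" if s: "1 < Re s" for s
  proof -
    have "summable (\<lambda>k. f k * shifted_zeta_term a s k)"
    proof (rule summable_comparison_test'[OF summable_shifted_zeta_term[OF a s]])
      show "norm (f k * shifted_zeta_term a s k) \<le> norm (shifted_zeta_term a s k)" for k
        using bound[of k] by (simp add: norm_mult mult_left_le_one_le)
    qed
    then obtain L where L: "(\<lambda>k. f k * shifted_zeta_term a s k) sums L" by (auto simp: summable_def)
    have "(\<lambda>i. \<Sum>k\<in>{i * q..<i * q + q}. f k * shifted_zeta_term a s k) sums L"
      by (rule sums_group[OF L q])
    moreover have "(\<lambda>i. \<Sum>j<q. f j * of_real (real q) powr (- s) * shifted_zeta_term ((real j + a) / real q) s i) sums g s"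
      unfolding g_def by (intro sums_sum sums_mult G(2) s)
    moreover have "(\<Sum>k\<in>{i * q..<i * q + q}. f k * shifted_zeta_term a s k)
        = (\<Sum>j<q. f j * of_real (real q) powr (- s) * shifted_zeta_term ((real j + a) / real q) s i)" for i
    proof (rule sum.reindex_bij_witness[of _ "\<lambda>j. i * q + j" "\<lambda>k. k - i * q"])
      fix k assume k: "k \<in> {i * q..<i * q + q}"
      define j where "j = k - i * q"
      have kj: "k = j + q * i" using k by (simp add: j_def mult.commute)
      have "f (j + q * i) = f j" by (rule periodic_add_mult[of f q, OF per])
      moreover have "real k + a = real q * (real i + (real j + a) / real q)"
        using q by (simp add: kj field_simps)
      then have "shifted_zeta_term a s k = of_real (real q) powr (- s) * shifted_zeta_term ((real j + a) / real q) s i"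
        unfolding shifted_zeta_term_def
        by (metis (no_types) Re_complex_of_real Reals_of_real a add_nonneg_nonneg divide_nonneg_nonneg
            of_nat_0_le_iff of_real_mult order_trans powr_times_real zero_le_one)
      ultimately show "f (k - i * q) * of_real (real q) powr (- s) * shifted_zeta_term ((real (k - i * q) + a) / real q) s i
          = f k * shifted_zeta_term a s k"
        unfolding j_def[symmetric] kj by simp
    qed auto
    ultimately have "L = g s" by (simp add: sums_iff)
    with L show ?thesis by simp
  qed
  ultimately show ?thesis by blast
qed

section \<open>Abel and Euler summation in the half plane Re s > 0\<close>

lemma shifted_powr_increments:
  fixes x :: real and s :: complex
  assumes x: "x > 0" and s: "Re s > -1"
  shows "norm (of_real x powr (- s) - of_real (x + 1) powr (- s)) \<le> norm s * x powr (- Re s - 1)" (is ?A)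
    and "s \<noteq> 1 \<Longrightarrow> norm (of_real x powr (- s) - (of_real x powr (1 - s) - of_real (x + 1) powr (1 - s)) / (s - 1))
      \<le> norm s * x powr (- Re s - 1)" (is "_ \<Longrightarrow> ?B")
proof -
  have *: "norm (of_real x powr (- s) - of_real (x + t) powr (- s)) \<le> norm s * x powr (- Re s - 1) * t"
    if t: "0 \<le> t" for t
  proof -
    have "norm (of_real (x + t) powr (- s) - of_real x powr (- s)) \<le> norm s * x powr (- Re s - 1) * norm (complex_of_real (x + t) - of_real x)"
    proof (rule field_differentiable_bound[where f = "\<lambda>z. z powr (- s)" and S = "closed_segment (of_real x) (of_real (x + t))"])
      fix z assume z: "z \<in> closed_segment (complex_of_real x) (of_real (x + t))"
      have "z \<in> complex_of_real ` closed_segment x (x + t)"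
        using z by (simp only: closed_segment_of_real)
      then obtain y where y: "z = of_real y" "x \<le> y" using t by (auto simp: closed_segment_eq_real_ivl)
      have "z \<notin> \<real>\<^sub>\<le>\<^sub>0" unfolding y(1) nonpos_Reals_of_real_iff using y x by auto
      then show "((\<lambda>z. z powr (- s)) has_field_derivative (- s) * z powr (- s - 1)) (at z within closed_segment (of_real x) (of_real (x + t)))"
        by (rule has_field_derivative_at_within[OF has_field_derivative_powr])
      have "norm (z powr (- s - 1)) \<le> x powr (- Re s - 1)"
        using y x s by (simp add: norm_of_real_powr powr_mono2')
      then show "norm ((- s) * z powr (- s - 1)) \<le> norm s * x powr (- Re s - 1)"
        by (simp add: norm_mult mult_left_mono)
    qed auto
    then show ?thesis using t by (simp add: norm_minus_commute)
  qed
  show ?A using *[of 1] by simp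
  show ?B if s1: "s \<noteq> 1"
  proof -
    \<comment> \<open>Up to a constant, \<open>\<phi>\<close> at t is t x^(-s) minus the integral of
      y^(-s) over [x, x + t], so its derivative is the increment x^(-s) - (x + t)^(-s) bounded
      above, and the claim is a mean value estimate on [0, 1].\<close>
    define \<phi> where "\<phi> = (\<lambda>z. z * of_real x powr (- s) + (of_real x + z) powr (1 - s) / (s - 1))"
    have "norm (\<phi> (of_real 1) - \<phi> (of_real 0)) \<le> norm s * x powr (- Re s - 1) * norm (complex_of_real 1 - of_real 0)"
    proof (rule field_differentiable_bound[where f = \<phi> and S = "closed_segment (of_real 0) (of_real 1)"])
      fix z assume z: "z \<in> closed_segment (complex_of_real 0) (of_real 1)"
      have "z \<in> complex_of_real ` closed_segment 0 1"
        using z by (simp only: closed_segment_of_real)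
      then obtain t where t: "z = of_real t" "0 \<le> t" "t \<le> 1" by (auto simp: closed_segment_eq_real_ivl)
      have "of_real x + z = of_real (x + t)" by (simp add: t)
      then have "of_real x + z \<notin> \<real>\<^sub>\<le>\<^sub>0" using t x by (simp only: nonpos_Reals_of_real_iff)
      then have "((\<lambda>z. (of_real x + z) powr (1 - s)) has_field_derivative (1 - s) * (of_real x + z) powr (- s)) (at z)"
        by (auto intro!: derivative_eq_intros)
      then have "(\<phi> has_field_derivative 1 * of_real x powr (- s) + (1 - s) * (of_real x + z) powr (- s) / (s - 1)) (at z)"
        unfolding \<phi>_def by (intro DERIV_add DERIV_cdivide DERIV_cmult_right DERIV_ident)
      moreover have "1 * of_real x powr (- s) + (1 - s) * (of_real x + z) powr (- s) / (s - 1)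
          = of_real x powr (- s) - (of_real x + z) powr (- s)"
      proof -
        have "(1 - s) / (s - 1) = -1" using s1 by (simp add: divide_eq_eq)
        then have "(1 - s) * (of_real x + z) powr (- s) / (s - 1) = - ((of_real x + z) powr (- s))"
          by (metis mult.commute mult_minus1_right times_divide_eq_right)
        then show ?thesis by simp
      qed
      ultimately show "(\<phi> has_field_derivative of_real x powr (- s) - (of_real x + z) powr (- s)) (at z within closed_segment (of_real 0) (of_real 1))"
        by (simp add: has_field_derivative_at_within)
      show "norm (of_real x powr (- s) - (of_real x + z) powr (- s)) \<le> norm s * x powr (- Re s - 1)"
        using *[OF t(2)] mult_left_mono[OF t(3), of "norm s * x powr (- Re s - 1)"] by (simp add: t)
    qed auto
    moreover have "\<phi> (of_real 1) - \<phi> (of_real 0)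
        = of_real x powr (- s) - (of_real x powr (1 - s) - of_real (x + 1) powr (1 - s)) / (s - 1)"
      by (simp add: \<phi>_def diff_divide_distrib)
    ultimately show ?thesis by simp
  qed
qed

lemma continuation_unique:
  assumes "open S" "connected S" "{s. 1 < Re s} \<subseteq> S"
    and "g holomorphic_on S" "h holomorphic_on S" "\<And>s. 1 < Re s \<Longrightarrow> g s = h s" "s \<in> S"
  shows "g s = h s"
proof (rule analytic_continuation_open[where s = "{s. 1 < Re s}" and s' = S and f = g and g = h])
  show "{s::complex. 1 < Re s} \<noteq> {}" by (auto intro: exI[of _ 2])
qed (use assms in \<open>auto intro: open_Re_gt\<close>)

text \<open>Any explicit continuation evaluates \<open>cont_value\<close>: the punctured plane is
  connected, so the identity theorem excludes a second value.\<close>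

lemma cont_value_eq:
  assumes g: "g holomorphic_on - {1}" "\<And>s. 1 < Re s \<Longrightarrow> f s = g s" and s: "s \<noteq> 1"
  shows "cont_value f s = g s"
  unfolding cont_value_def
proof (rule the_equality)
  show "\<exists>h. h holomorphic_on - {1} \<and> (\<forall>z. 1 < Re z \<longrightarrow> h z = f z) \<and> h s = g s"
    using g by auto
next
  fix w assume "\<exists>h. h holomorphic_on - {1} \<and> (\<forall>z. 1 < Re z \<longrightarrow> h z = f z) \<and> h s = w"
  then obtain h where h: "h holomorphic_on - {1}" "\<And>z. 1 < Re z \<Longrightarrow> h z = f z" "h s = w" by blast
  have "h s = g s"
    by (rule continuation_unique[where S = "- {1}"])
       (use g h s connected_open_delete[of "UNIV :: complex set" 1] in \<open>auto simp: Compl_eq_Diff_UNIV\<close>)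
  with h show "w = g s" by simp
qed

text \<open>Abel summation against the centred partial sums \<open>G n\<close> of the coefficients, together with Euler summation
  of the mean \<open>\<mu>\<close>, continues the series to \<open>Re s > 0\<close>.\<close>
definition abel_term :: "(nat \<Rightarrow> complex) \<Rightarrow> complex \<Rightarrow> real \<Rightarrow> nat \<Rightarrow> complex \<Rightarrow> complex" where
  "abel_term G \<mu> a k s =
     G (Suc k) * (of_real (real k + a) powr (- s) - of_real (real k + a + 1) powr (- s)) +
     \<mu> * (of_real (real k + a) powr (- s)
       - (of_real (real k + a) powr (1 - s) - of_real (real k + a + 1) powr (1 - s)) / (s - 1))"

lemma abel_continuation:
  fixes f :: "nat \<Rightarrow> complex" and a A :: real and \<mu> :: complex
  assumes a: "a \<ge> 1" and G: "\<And>n. norm (\<Sum>k<n. f k - \<mu>) \<le> A" and A: "A \<ge> 0"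
    and g: "g holomorphic_on - {1}"
      "\<And>s. 1 < Re s \<Longrightarrow> (\<lambda>k. f k * shifted_zeta_term a s k) sums g s"
    and s: "0 < Re s" "s \<noteq> 1"
  defines "G \<equiv> \<lambda>n. \<Sum>k<n. f k - \<mu>"
  shows "g s = \<mu> * (of_real a powr (1 - s) / (s - 1)) + (\<Sum>k. abel_term G \<mu> a k s)"
    and "summable (\<lambda>k. abel_term G \<mu> a k s)"
proof -
  define S where "S = {s::complex. 0 < Re s} - {1}"
  define H where "H = (\<lambda>s. \<mu> * (of_real a powr (1 - s) / (s - 1)) + (\<Sum>k. abel_term G \<mu> a k s))"
  have X: "real k + a > 0" "real k + a + 1 > 0" for k using a by (auto intro: add_nonneg_pos)
  have npos: "complex_of_real x \<notin> \<real>\<^sub>\<le>\<^sub>0" if "x > 0" for x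
    using that by (simp only: nonpos_Reals_of_real_iff)
  have "connected {s::complex. 0 < Re s}" by (intro convex_connected convex_halfspace_Re_gt)
  then have S: "open S" "connected S" "{s. 1 < Re s} \<subseteq> S" "S \<subseteq> {s. 0 < Re s}"
    unfolding S_def by (auto intro!: connected_open_delete open_Re_gt open_delete)
  have bound: "\<exists>C. \<forall>n. \<forall>z\<in>S. norm z \<le> R \<longrightarrow> norm (abel_term G \<mu> a n z) \<le> C * (real n + a) powr (0 - 1 - Re z)" for R
  proof (intro exI allI ballI impI)
    fix n z assume z: "z \<in> S" "norm z \<le> R"
    have le: "norm z * (real n + a) powr (- Re z - 1) \<le> R * (real n + a) powr (- Re z - 1)"
      using z by (intro mult_right_mono) auto
    have zS: "Re z > -1" "z \<noteq> 1" using z by (auto simp: S_def)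
    have "norm (abel_term G \<mu> a n z) \<le> A * (R * (real n + a) powr (- Re z - 1)) + norm \<mu> * (R * (real n + a) powr (- Re z - 1))"
      unfolding abel_term_def G_def
      by (intro order_trans[OF norm_triangle_ineq] add_mono; unfold norm_mult)
         (intro mult_mono G order_trans[OF shifted_powr_increments(1) le] order_trans[OF shifted_powr_increments(2) le] zS X A order_refl norm_ge_zero)+
    moreover have "0 - 1 - Re z = - Re z - 1" by simp
    ultimately show "norm (abel_term G \<mu> a n z) \<le> ((A + norm \<mu>) * R) * (real n + a) powr (0 - 1 - Re z)"
      by (simp only: distrib_right distrib_left mult_ac)
  qed
  have hol: "(\<lambda>s. abel_term G \<mu> a k s) holomorphic_on S" for k
    unfolding abel_term_def by (intro holomorphic_intros npos X) (auto simp: S_def)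
  have "(\<lambda>s. \<Sum>k. abel_term G \<mu> a k s) holomorphic_on S"
    by (rule holomorphic_on_halfplane_series[OF S(1,4) a hol bound])
  then have H_hol: "H holomorphic_on S"
    unfolding H_def using a by (intro holomorphic_intros npos) (auto simp: S_def)
  have summ: "summable (\<lambda>k. abel_term G \<mu> a k z)" if "z \<in> S" for z
    by (rule summable_norm_cancel[OF summable_halfplane_series[OF S(1,4) a hol bound that]])
  have eq: "g z = H z" if z: "1 < Re z" for z
  proof -
    have zS: "z \<in> S" using S z by auto
    have z1: "z \<noteq> 1" using z by auto
    let ?w = "\<lambda>k. complex_of_real (real k + a) powr (- z)"
    let ?v = "\<lambda>k. complex_of_real (real k + a) powr (1 - z)"
    have tend: "(\<lambda>k. complex_of_real (real k + a) powr c) \<longlonglongrightarrow> 0" if "Re c < 0" for c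
    proof (rule tendsto_norm_zero_cancel)
      have "filterlim (\<lambda>k. real k + a) at_top sequentially"
        by (subst add.commute)
           (rule filterlim_tendsto_add_at_top[OF tendsto_const filterlim_real_sequentially])
      then have "(\<lambda>k. (real k + a) powr Re c) \<longlonglongrightarrow> 0" using that by (intro tendsto_neg_powr)
      moreover have "norm (complex_of_real (real k + a) powr c) = (real k + a) powr Re c" for k
        using X(1)[of k] by (intro norm_of_real_powr) auto
      ultimately show "(\<lambda>k. norm (complex_of_real (real k + a) powr c)) \<longlonglongrightarrow> 0" by simp
    qed
    have Gw: "(\<lambda>k. G k * ?w k) \<longlonglongrightarrow> 0"
    proof (rule tendsto_norm_zero_cancel, rule tendsto_sandwich[OF _ _ tendsto_const])
      show "(\<lambda>k. A * norm (?w k)) \<longlonglongrightarrow> 0"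
        using tendsto_mult_right_zero[OF tendsto_norm_zero[OF tend], of "- z" A] z by simp
      show "\<forall>\<^sub>F k in sequentially. norm (G k * ?w k) \<le> A * norm (?w k)"
        unfolding norm_mult G_def by (intro always_eventually allI mult_right_mono G) auto
    qed auto
    \<comment> \<open>Since f k - \<mu> = G (k + 1) - G k, this is an increment of G w, and G 0 = 0
      makes the total zero. The Euler part telescopes separately to the boundary term at
      \<open>a\<close>, which carries the possible pole at s = 1.\<close>
    have "(\<lambda>k. f k * ?w k - (G (Suc k) * (?w k - ?w (Suc k)) + \<mu> * ?w k)) = (\<lambda>k. G (Suc k) * ?w (Suc k) - G k * ?w k)"
      by (simp add: G_def algebra_simps fun_eq_iff)
    with telescope_sums[OF Gw]
    have t1: "(\<lambda>k. f k * ?w k - (G (Suc k) * (?w k - ?w (Suc k)) + \<mu> * ?w k)) sums 0"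
      by (simp add: G_def)
    have t2: "(\<lambda>k. ?v k - ?v (Suc k)) sums (of_real a powr (1 - z))"
      using telescope_sums'[OF tend, of "1 - z"] z by simp
    have t3: "(\<lambda>k. \<mu> * ((?v k - ?v (Suc k)) / (z - 1))) sums (\<mu> * (of_real a powr (1 - z) / (z - 1)))"
      by (intro sums_mult sums_divide t2)
    have "(\<lambda>k. f k * ?w k) sums (0 + \<mu> * (of_real a powr (1 - z) / (z - 1)) + (\<Sum>k. abel_term G \<mu> a k z))"
    proof (rule sums_cong[THEN iffD1, OF _ sums_add[OF sums_add[OF t1 t3] summable_sums[OF summ[OF zS]]]])
      fix k
      have e: "real (Suc k) + a = real k + a + 1" by simp
      show "f k * ?w k - (G (Suc k) * (?w k - ?w (Suc k)) + \<mu> * ?w k) + \<mu> * ((?v k - ?v (Suc k)) / (z - 1))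
          + abel_term G \<mu> a k z = f k * ?w k"
        unfolding abel_term_def e by (simp only: algebra_simps) 
    qed
    moreover have "(\<lambda>k. f k * ?w k) sums g z"
      using g(2)[OF z] by (simp only: shifted_zeta_term_def)
    ultimately show ?thesis by (simp add: sums_iff H_def)
  qed
  have "g s = H s"
  proof (rule continuation_unique[where S = S and g = g and h = H])
    show "g holomorphic_on S" by (rule holomorphic_on_subset[OF g(1)]) (auto simp: S_def)
  qed (use S(1-3) H_hol eq s in \<open>auto simp: S_def\<close>)
  then show "g s = \<mu> * (of_real a powr (1 - s) / (s - 1)) + (\<Sum>k. abel_term G \<mu> a k s)"
    by (simp add: H_def)
  show "summable (\<lambda>k. abel_term G \<mu> a k s)" using s by (intro summ) (auto simp: S_def)
qed

section \<open>Values at one half\<close>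

text \<open>With u = sqrt x and v = sqrt (x + 1) everything reduces to (v - u) (v + u) = 1. The last
  part concerns the Euler term at s = 1/2: the integral of y^(-1/2) over [x, x + 1] is 2 (v - u),
  between 1/v and 1/u. Abel and Euler terms thereby share one telescoping majorant.\<close>

lemma inverse_sqrt_increments:
  fixes x :: real
  assumes x: "x > 0"
  shows "0 \<le> 1 / sqrt x - 1 / sqrt (x + 1)"
    and "1 / sqrt x - 1 / sqrt (x + 1) \<le> 1 / (2 * x * sqrt x)"
    and "\<bar>1 / sqrt x + 2 * (sqrt x - sqrt (x + 1))\<bar> \<le> 1 / sqrt x - 1 / sqrt (x + 1)"
proof -
  define u v where "u = sqrt x" and "v = sqrt (x + 1)"
  have u: "u > 0" "u \<le> v" "v > 0" using x by (auto simp: u_def v_def)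
  have uv: "(v - u) * (v + u) = 1"
    using x by (simp add: u_def v_def algebra_simps)
  then have d: "v - u = 1 / (v + u)" using u by (simp add: field_simps)
  have "1 / u - 1 / v = (v - u) / (u * v)" using u by (simp add: field_simps)
  also have "\<dots> = 1 / (u * v * (u + v))" by (simp add: d add.commute)
  also have "\<dots> \<le> 1 / (u * u * (u + u))"
    using u by (intro divide_left_mono mult_mono add_mono mult_pos_pos add_pos_pos) auto
  also have "u * u * (u + u) = 2 * x * sqrt x" using x by (simp add: u_def)
  finally show "1 / sqrt x - 1 / sqrt (x + 1) \<le> 1 / (2 * x * sqrt x)" by (simp add: u_def v_def)
  show "0 \<le> 1 / sqrt x - 1 / sqrt (x + 1)" using x by (simp add: frac_le)
  have "2 * (v - u) \<le> 1 / u" unfolding d using u by (simp add: field_simps)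
  moreover have "1 / v \<le> 2 * (v - u)" unfolding d using u by (simp add: field_simps)
  ultimately show "\<bar>1 / sqrt x + 2 * (sqrt x - sqrt (x + 1))\<bar> \<le> 1 / sqrt x - 1 / sqrt (x + 1)"
    unfolding u_def v_def by (simp add: abs_if algebra_simps)
qed

lemma of_real_powr_half:
  assumes "x > 0"
  shows "complex_of_real x powr (- (1 / 2)) = of_real (1 / sqrt x)"
    and "complex_of_real x powr (1 - 1 / 2) = of_real (sqrt x)"
proof -
  have "complex_of_real x powr (- (1 / 2)) = of_real x powr of_real (- (1 / 2))" by simp
  also have "\<dots> = of_real (x powr - (1 / 2))" using assms by (intro powr_of_real) auto
  also have "x powr - (1 / 2) = 1 / sqrt x" using assms by (simp only: powr_minus powr_half_sqrt inverse_eq_divide less_imp_le)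
  finally show "complex_of_real x powr (- (1 / 2)) = of_real (1 / sqrt x)" .
  have "complex_of_real x powr (1 - 1 / 2) = of_real x powr of_real (1 / 2)" by simp
  also have "\<dots> = of_real (x powr (1 / 2))" using assms by (intro powr_of_real) auto
  finally show "complex_of_real x powr (1 - 1 / 2) = of_real (sqrt x)"
    using assms by (simp only: powr_half_sqrt less_imp_le)
qed

lemma norm_abel_term_half:
  assumes a: "a > 0" and B: "norm (G (Suc k)) \<le> B" and \<mu>: "norm \<mu> \<le> 1"
  shows "norm (abel_term G \<mu> a k (1 / 2)) \<le> (B + 1) * (1 / sqrt (real k + a) - 1 / sqrt (real k + a + 1))"
proof -
  define x where "x = real k + a"
  have x: "x > 0" "x + 1 > 0" using a by (auto simp: x_def intro: add_nonneg_pos)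
  have "abel_term G \<mu> a k (1 / 2) = G (Suc k) * of_real (1 / sqrt x - 1 / sqrt (x + 1))
      + \<mu> * of_real (1 / sqrt x + 2 * (sqrt x - sqrt (x + 1)))"
    unfolding abel_term_def x_def[symmetric] of_real_powr_half[OF x(1)] of_real_powr_half[OF x(2)]
    by simp
  also have "norm \<dots> \<le> B * (1 / sqrt x - 1 / sqrt (x + 1)) + 1 * (1 / sqrt x - 1 / sqrt (x + 1))"
  proof (intro order_trans[OF norm_triangle_ineq] add_mono; unfold norm_mult norm_of_real)
    show "norm (G (Suc k)) * \<bar>1 / sqrt x - 1 / sqrt (x + 1)\<bar> \<le> B * (1 / sqrt x - 1 / sqrt (x + 1))"
      using inverse_sqrt_increments(1)[OF x(1)] B by (simp only: abs_of_nonneg mult_right_mono)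
    show "norm \<mu> * \<bar>1 / sqrt x + 2 * (sqrt x - sqrt (x + 1))\<bar> \<le> 1 * (1 / sqrt x - 1 / sqrt (x + 1))"
      by (intro mult_mono inverse_sqrt_increments(3) x \<mu>) auto
  qed
  finally show ?thesis by (simp only: x_def distrib_right)
qed

text \<open>The partial sums \<open>G n\<close> are bounded by \<open>2 n\<close> for \<open>n \<le> A\<close> and by \<open>A\<close> afterwards; both ranges
  contribute a multiple of \<open>sqrt A\<close>.\<close>
lemma continuation_half_bound:
  fixes f :: "nat \<Rightarrow> complex" and a A :: real and \<mu> :: complex
  assumes a: "a \<ge> 1" "a \<le> 2" and f: "\<And>k. norm (f k) \<le> 1" and \<mu>: "norm \<mu> \<le> 1"
    and G: "\<And>n. norm (\<Sum>k<n. f k - \<mu>) \<le> A" and A: "A \<ge> 1"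
    and g: "g holomorphic_on - {1}"
      "\<And>s. 1 < Re s \<Longrightarrow> (\<lambda>k. f k * shifted_zeta_term a s k) sums g s"
  shows "norm (g (1 / 2)) \<le> 12 * sqrt A"
proof -
  define G where "G = (\<lambda>n. \<Sum>k<n. f k - \<mu>)"
  define t where "t = (\<lambda>k. abel_term G \<mu> a k (1 / 2))"
  define T where "T = (\<Sum>k. t k)"
  define K where "K = nat \<lceil>A\<rceil>"
  have a0: "a > 0" using a by simp
  have A0: "A \<ge> 0" using A by simp
  have half: "(1 / 2 :: complex) \<noteq> 1" by simp
  have g_half: "g (1 / 2) = \<mu> * (of_real a powr (1 - 1 / 2) / (1 / 2 - 1)) + T" and "summable t"
    using abel_continuation[OF a(1) assms(5) A0 g, of "1 / 2"] half by (auto simp: T_def t_def G_def)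
  then have T: "t sums T" by (simp add: T_def summable_sums)
  have K: "real K \<ge> A" "real K \<le> A + 1" "K > 0"
    using A by (auto simp: K_def)
  \<comment> \<open>The trivial bound 2 (k + 1) for the partial sum against an increment of size (k
    + a)^(-3/2) leaves a multiple of (k + 1)^(-1/2), which is traded for an increment of the square
    root so that the sum up to \<open>K\<close> telescopes.\<close>
  have small: "norm (t k) \<le> 4 * (sqrt (real (Suc k)) - sqrt (real k))" for k
  proof -
    have "norm (G (Suc k)) \<le> (\<Sum>i<Suc k. 2)"
      unfolding G_def by (intro sum_norm_le order_trans[OF norm_triangle_ineq4] order_trans[OF add_mono[OF f \<mu>]]) auto
    then have "norm (G (Suc k)) \<le> 2 * real k + 2" by simp
    from norm_abel_term_half[where G = G, OF a0 this \<mu>]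
    have "norm (t k) \<le> (2 * real k + 2 + 1) * (1 / sqrt (real k + a) - 1 / sqrt (real k + a + 1))"
      by (simp only: t_def)
    also have "\<dots> \<le> (3 * (real k + a)) * (1 / (2 * (real k + a) * sqrt (real k + a)))"
      using a by (intro mult_mono inverse_sqrt_increments) auto
    also have "\<dots> = 3 / 2 * (1 / sqrt (real k + a))"
    proof -
      have "(3 * y) * (1 / (2 * y * sqrt y)) = 3 / 2 * (1 / sqrt y)" if "y > 0" for y :: real
        using that by simp
      then show ?thesis using a0 by (simp only: add_nonneg_pos of_nat_0_le_iff)
    qed
    also have "\<dots> \<le> 2 * (1 / sqrt (real (Suc k)))"
      using a by (intro mult_mono frac_le) auto
    also have "1 / sqrt (real (Suc k)) \<le> 2 * (sqrt (real (Suc k)) - sqrt (real k))"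
    proof -
      have "(sqrt (real (Suc k)) - sqrt (real k)) * (sqrt (real (Suc k)) + sqrt (real k)) = 1"
        by (simp add: algebra_simps)
      then have "sqrt (real (Suc k)) - sqrt (real k) = 1 / (sqrt (real (Suc k)) + sqrt (real k))"
        by (metis eq_divide_eq mult_zero_right zero_neq_one)
      also have "\<dots> \<ge> 1 / (sqrt (real (Suc k)) + sqrt (real (Suc k)))"
        by (intro divide_left_mono add_mono mult_pos_pos add_pos_nonneg) auto
      finally show ?thesis by simp
    qed
    finally show ?thesis by simp
  qed
  have "norm (\<Sum>k<K. t k) \<le> (\<Sum>k<K. 4 * (sqrt (real (Suc k)) - sqrt (real k)))"
    by (intro sum_norm_le small)
  also have "\<dots> = 4 * sqrt (real K)"
    by (subst sum_distrib_left[symmetric], subst sum_lessThan_telescope) simp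
  finally have head: "norm (\<Sum>k<K. t k) \<le> 4 * sqrt (real K)" .
  have "(\<lambda>k. 1 / sqrt (real k + a)) \<longlonglongrightarrow> 0" by real_asymp
  then have "(\<lambda>k. 1 / sqrt (real (k + K) + a)) \<longlonglongrightarrow> 0" by (rule LIMSEQ_ignore_initial_segment)
  from sums_mult[OF telescope_sums'[OF this], of "A + 1"]
  have tel: "(\<lambda>k. (A + 1) * (1 / sqrt (real (k + K) + a) - 1 / sqrt (real (k + K) + a + 1))) sums ((A + 1) * (1 / sqrt (real K + a)))"
    by (simp add: add_ac)
  have tail: "norm (T - (\<Sum>k<K. t k)) \<le> (A + 1) * (1 / sqrt (real K + a))"
  proof (rule norm_sums_le[OF sums_split_initial_segment[OF T] tel])
    show "norm (t (k + K)) \<le> (A + 1) * (1 / sqrt (real (k + K) + a) - 1 / sqrt (real (k + K) + a + 1))" for k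
      unfolding t_def by (intro norm_abel_term_half a0 \<mu>) (simp only: G_def G)
  qed
  also have "(A + 1) * (1 / sqrt (real K + a)) \<le> 2 * sqrt A"
  proof -
    have "(A + 1) * (1 / sqrt (real K + a)) \<le> (2 * A) * (1 / sqrt A)"
      using A K a by (intro mult_mono frac_le) auto
    also have "\<dots> = 2 * (A / sqrt A)" by simp
    also have "A / sqrt A = sqrt A" using A by (intro real_div_sqrt) simp
    finally show ?thesis .
  qed
  finally have tail': "norm (T - (\<Sum>k<K. t k)) \<le> 2 * sqrt A" .
  \<comment> \<open>K <= A + 1 <= 2 A, and 9/4 is a convenient rational square above 2.\<close>
  have sqrtK: "sqrt (real K) \<le> 3 / 2 * sqrt A"
  proof -
    have "sqrt (real K) \<le> sqrt ((9 / 4) * A)" using K A by simp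
    also have "\<dots> = 3 / 2 * sqrt A" by (simp add: real_sqrt_mult real_sqrt_divide)
    finally show ?thesis .
  qed
  \<comment> \<open>The head gives 4 times 3/2 and the tail 2, together 8; the boundary term 2 sqrt
    a <= 4 supplies the rest of 12, using A >= 1.\<close>
  have "norm T \<le> norm (\<Sum>k<K. t k) + norm (T - (\<Sum>k<K. t k))"
    using norm_triangle_ineq[of "\<Sum>k<K. t k" "T - (\<Sum>k<K. t k)"] by simp
  then have normT: "norm T \<le> 8 * sqrt A" using head tail' sqrtK by linarith
  have "norm (\<mu> * (of_real a powr (1 - 1 / 2) / (1 / 2 - 1))) = norm \<mu> * (2 * sqrt a)"
    unfolding of_real_powr_half(2)[OF a0] using a0 by (simp add: norm_mult norm_divide)
  also have "\<dots> \<le> 1 * (2 * 2)"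
  proof (intro mult_mono \<mu>)
    show "sqrt a \<le> 2" using a by (intro real_le_lsqrt) auto
  qed (use a0 in auto)
  also have "\<dots> \<le> 4 * sqrt A" using A by simp
  finally have "norm (\<mu> * (of_real a powr (1 - 1 / 2) / (1 / 2 - 1))) \<le> 4 * sqrt A" .
  then show ?thesis
    unfolding g_half using normT by (intro order_trans[OF norm_triangle_ineq]) linarith
qed

text \<open>The prefactor l^s turns (b + k l)^(-s) into (k + b/l)^(-s). The term k = 0 is kept apart
  because b/l has no uniform lower bound. As 1 <= b < l, the positive n in the class of b are
  exactly the b + k l with k >= 0.\<close>

lemma hurwitz_series_continuation:
  fixes b l :: nat
  assumes b: "1 \<le> b" "b < l" and s: "1 < Re s"
    and chi: "\<And>n. norm (chi n) \<le> 1"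
    and g: "(\<lambda>k. chi (b + l + k * l) * shifted_zeta_term (1 + real b / real l) s k) sums g"
  shows "hurwitz_series chi b l s = chi b * of_real (real b / real l) powr (- s) + g"
proof -
  define F where "F = (\<lambda>k. chi (b + k * l) * shifted_zeta_term (real b / real l) s k)"
  define L where "L = chi b * of_real (real b / real l) powr (- s) + g"
  have l: "l > 0" using b by simp
  have F_Suc: "F (Suc k) = chi (b + l + k * l) * shifted_zeta_term (1 + real b / real l) s k" for k
    by (simp add: F_def shifted_zeta_term_def add_ac)
  have "F sums (g + F 0)" by (rule sums_Suc) (simp only: F_Suc g)
  then have F: "F sums L" by (simp add: L_def F_def shifted_zeta_term_def add.commute)
  have "summable (\<lambda>k. norm (F (Suc k)))"
  proof (rule summable_comparison_test')
    show "summable (\<lambda>k. norm (shifted_zeta_term (1 + real b / real l) s k))"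
      using s by (intro summable_shifted_zeta_term) auto
    show "norm (norm (F (Suc k))) \<le> norm (shifted_zeta_term (1 + real b / real l) s k)" for k
      unfolding F_Suc using chi by (simp add: norm_mult mult_left_le_one_le)
  qed
  then have "summable (\<lambda>k. norm (F k))" by (subst (asm) summable_Suc_iff)
  then have hs: "(F has_sum L) UNIV" by (rule norm_summable_imp_has_sum[OF _ F])
  have lnz: "of_nat l powr s \<noteq> 0" using l by simp
  have Fk: "F k / of_nat l powr s = chi (b + k * l) / of_nat (b + k * l) powr s" for k
  proof -
    have "of_nat (b + k * l) = complex_of_real (real l * (real k + real b / real l))"
      using l by (simp add: field_simps)
    also have "\<dots> powr s = of_nat l powr s * of_real (real k + real b / real l) powr s"
      unfolding of_real_mult by (subst powr_times_real) auto
    finally show ?thesis by (simp add: F_def shifted_zeta_term_def powr_minus field_simps)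
  qed
  have bij: "bij_betw (\<lambda>k. b + k * l) UNIV {n. 1 \<le> n \<and> n mod l = b mod l}"
  proof (rule bij_betw_imageI)
    show "inj (\<lambda>k. b + k * l)" using l by (auto simp: inj_on_def)
    show "range (\<lambda>k. b + k * l) = {n. 1 \<le> n \<and> n mod l = b mod l}"
    proof (intro equalityI subsetI)
      fix n assume "n \<in> {n. 1 \<le> n \<and> n mod l = b mod l}"
      then have "n mod l = b" using b by simp
      then have "n = b + (n div l) * l" using div_mult_mod_eq[of n l] by linarith
      then show "n \<in> range (\<lambda>k. b + k * l)" by blast
    qed (use b in auto)
  qed
  have "((\<lambda>k. chi (b + k * l) / of_nat (b + k * l) powr s) has_sum (L / of_nat l powr s)) UNIV"
    using has_sum_cmult_left[OF hs, of "1 / of_nat l powr s"] by (simp only: times_divide_eq_right mult_1_right Fk)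
  then have "((\<lambda>n. chi n / of_nat n powr s) has_sum (L / of_nat l powr s)) {n. 1 \<le> n \<and> n mod l = b mod l}"
    using has_sum_reindex_bij_betw[OF bij, of "\<lambda>n. chi n / of_nat n powr s"] by simp
  then have "infsum (\<lambda>n. chi n / of_nat n powr s) {n. 1 \<le> n \<and> n mod l = b mod l} = L / of_nat l powr s"
    by (rule infsumI)
  then show ?thesis using lnz by (simp add: hurwitz_series_def L_def)
qed

text \<open>The difference is the continued series with coefficients chi (b + l + k l) and parameter
  1 + b/l in [1, 2]. The character sum bound is invoked with 2 \<epsilon> because the estimate at
  1/2 takes the square root of \<open>A\<close>.\<close>

lemma hurwitz_L_half_bound:
  fixes \<epsilon> :: real
  assumes "\<epsilon> > 0"
  shows "\<exists>C\<ge>1. \<forall>q chi b l. dirichlet_character q chi \<longrightarrow> 1 \<le> b \<longrightarrow> b < l \<longrightarrow>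
    norm (hurwitz_L chi b l (1 / 2) - chi b * of_real (sqrt (real l / real b))) \<le> C * real q powr (1 / 4 + \<epsilon>)"
proof -
  have "2 * \<epsilon> > 0" using assms by simp
  from polya_vinogradov_ap[OF this] obtain C where C: "C \<ge> 1"
    "\<And>q chi b l. dirichlet_character q chi \<Longrightarrow> l > 0 \<Longrightarrow>
      \<exists>\<mu>. norm \<mu> \<le> 1 \<and> (\<forall>n. norm (\<Sum>k<n. chi (b + k * l) - \<mu>) \<le> C * real q powr (1/2 + 2 * \<epsilon>))"
    by blast
  have "norm (hurwitz_L chi b l (1 / 2) - chi b * of_real (sqrt (real l / real b))) \<le> (12 * sqrt C) * real q powr (1 / 4 + \<epsilon>)"
    if chi: "dirichlet_character q chi" and b: "1 \<le> b" "b < l" for q chi b l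
  proof -
    note D = dirichlet_characterD[OF chi]
    define a where "a = 1 + real b / real l"
    define f where "f = (\<lambda>k. chi (b + l + k * l))"
    define A where "A = C * real q powr (1/2 + 2 * \<epsilon>)"
    have l: "l > 0" using b by simp
    have a: "a \<ge> 1" "a \<le> 2" using b by (auto simp: a_def)
    have per: "f (k + q) = f k" for k
      unfolding f_def using periodic_add_mult[of chi q, OF D(2), of "b + l + k * l" l] by (simp add: algebra_simps)
    have f_le: "norm (f k) \<le> 1" for k unfolding f_def by (rule norm_dirichlet_character_le[OF chi])
    obtain g where g: "g holomorphic_on - {1}"
      "\<And>s. 1 < Re s \<Longrightarrow> (\<lambda>k. f k * shifted_zeta_term a s k) sums g s"
      using periodic_series_continuation[where f = f, OF a(1) D(1) per f_le] by blast
    obtain \<mu> where \<mu>: "norm \<mu> \<le> 1" "\<And>n. norm (\<Sum>k<n. f k - \<mu>) \<le> A"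
      using C(2)[OF chi l, of "b + l"] unfolding f_def A_def by blast
    have q1: "real q \<ge> 1" using D(1) by simp
    have "1 * 1 \<le> A"
      unfolding A_def using C q1 assms by (intro mult_mono ge_one_powr_ge_zero) auto
    then have A: "A \<ge> 1" by simp
    define h where "h = (\<lambda>s. chi b * of_real (real b / real l) powr (- s) + g s)"
    have bl: "real b / real l > 0" using b by simp
    then have "complex_of_real (real b / real l) \<notin> \<real>\<^sub>\<le>\<^sub>0" by (simp only: nonpos_Reals_of_real_iff)
    then have "h holomorphic_on - {1}" unfolding h_def by (intro holomorphic_intros g(1))
    moreover have "hurwitz_series chi b l s = h s" if "1 < Re s" for s
      unfolding h_def
      by (rule hurwitz_series_continuation[OF b that norm_dirichlet_character_le[OF chi] g(2)[OF that, unfolded f_def a_def]])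
    ultimately have "hurwitz_L chi b l (1 / 2) = h (1 / 2)"
      unfolding hurwitz_L_def by (rule cont_value_eq) auto
    also have "\<dots> = chi b * of_real (sqrt (real l / real b)) + g (1 / 2)"
      unfolding h_def of_real_powr_half(1)[OF bl] by (simp add: real_sqrt_divide)
    finally have "hurwitz_L chi b l (1 / 2) - chi b * of_real (sqrt (real l / real b)) = g (1 / 2)" by simp
    moreover have "norm (g (1 / 2)) \<le> 12 * sqrt A"
      by (rule continuation_half_bound[OF a f_le \<mu> A g])
    moreover have "sqrt A = sqrt C * real q powr (1 / 4 + \<epsilon>)"
      unfolding A_def real_sqrt_mult powr_half_sqrt[symmetric, OF powr_ge_zero] powr_powr
      by (simp add: field_simps)
    ultimately show ?thesis by simp
  qed
  moreover have "12 * sqrt C \<ge> 1"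
    using C(1) real_sqrt_ge_one[of C] by linarith
  ultimately show ?thesis by blast
qed

text \<open>Even at a point of absolute convergence \<open>cont_value\<close> is meaningful only
  once a continuation to - {1} exists; periodicity of \<open>c\<close> supplies it.\<close>

lemma dirichlet_L_eq_suminf:
  fixes c :: "nat \<Rightarrow> complex"
  assumes q: "q > 0" and per: "\<And>k. c (k + q) = c k" and bound: "\<And>k. norm (c k) \<le> 1" and s: "1 < Re s"
  shows "dirichlet_L c s = (\<Sum>k. c (Suc k) * of_nat (Suc k) powr (- s))"
proof -
  obtain g where g: "g holomorphic_on - {1}"
    "\<And>s. 1 < Re s \<Longrightarrow> (\<lambda>k. c (Suc k) * shifted_zeta_term 1 s k) sums g s"
    using periodic_series_continuation[where f = "\<lambda>k. c (Suc k)" and a = 1, OF _ q] per[of "Suc k" for k] bound by auto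
  have zt: "shifted_zeta_term 1 z k = of_nat (Suc k) powr (- z)" for z k
    by (simp add: shifted_zeta_term_def add.commute)
  have "infsum (\<lambda>n. c n / of_nat n powr z) {n. 1 \<le> n} = g z" if z: "1 < Re z" for z
  proof -
    have "summable (\<lambda>k. norm (c (Suc k) * shifted_zeta_term 1 z k))"
    proof (rule summable_comparison_test'[OF summable_shifted_zeta_term[of 1 z]])
      show "norm (norm (c (Suc k) * shifted_zeta_term 1 z k)) \<le> norm (shifted_zeta_term 1 z k)" for k
        using bound[of "Suc k"] by (simp add: norm_mult mult_left_le_one_le)
    qed (use z in auto)
    from norm_summable_imp_has_sum[OF this g(2)[OF z]]
    have "((\<lambda>k. c (Suc k) / of_nat (Suc k) powr z) has_sum g z) UNIV"
      by (simp only: zt powr_minus divide_inverse)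
    moreover have "bij_betw Suc UNIV {n. 1 \<le> n}"
      by (rule bij_betw_imageI) (auto simp: image_iff Suc_le_eq gr0_conv_Suc)
    ultimately have "((\<lambda>n. c n / of_nat n powr z) has_sum g z) {n. 1 \<le> n}"
      using has_sum_reindex_bij_betw[of Suc UNIV "{n. 1 \<le> n}" "\<lambda>n. c n / of_nat n powr z" "g z"] by simp
    then show ?thesis by (rule infsumI)
  qed
  then have "dirichlet_L c s = g s"
    unfolding dirichlet_L_def using s by (intro cont_value_eq g(1)) auto
  then show ?thesis using g(2)[OF s] by (simp add: sums_iff zt)
qed

section \<open>The twisted moment\<close>

text \<open>In the expanded product every term except the product of the \<open>y i\<close> contains
  some \<open>r i\<close>; factorwise bounds give the same expansion of (x + B)^m without x^m. The
  induction peels off one factor at a time.\<close>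

lemma norm_prod_add_diff_le:
  fixes y r :: "nat \<Rightarrow> complex"
  assumes "\<And>i. i < m \<Longrightarrow> norm (y i) \<le> x" "\<And>i. i < m \<Longrightarrow> norm (r i) \<le> B"
  shows "norm ((\<Prod>i<m. y i + r i) - (\<Prod>i<m. y i)) \<le> (x + B) ^ m - x ^ m"
  using assms
proof (induction m)
  case (Suc m)
  define P Q where "P = (\<Prod>i<m. y i + r i)" and "Q = (\<Prod>i<m. y i)"
  have xB: "0 \<le> x" "0 \<le> B" using Suc.prems[of 0] norm_ge_zero[of "y 0"] norm_ge_zero[of "r 0"] by linarith+
  have yr: "norm (y m + r m) \<le> x + B" "norm (r m) \<le> B"
    using Suc.prems[of m] norm_triangle_ineq[of "y m" "r m"] by auto
  have Q: "norm Q \<le> x ^ m"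
    using prod_mono[of "{..<m}" "\<lambda>i. norm (y i)" "\<lambda>_. x"] Suc.prems(1) by (simp add: Q_def prod_norm)
  have IH: "norm (P - Q) \<le> (x + B) ^ m - x ^ m"
    unfolding P_def Q_def using Suc.prems by (intro Suc.IH) auto
  have "(\<Prod>i<Suc m. y i + r i) - (\<Prod>i<Suc m. y i) = (P - Q) * (y m + r m) + Q * r m"
    by (simp add: P_def Q_def algebra_simps)
  also have "norm \<dots> \<le> ((x + B) ^ m - x ^ m) * (x + B) + x ^ m * B"
    by (intro order_trans[OF norm_triangle_ineq] add_mono; unfold norm_mult)
       (intro mult_mono IH yr Q norm_ge_zero order_trans[OF norm_ge_zero IH] zero_le_power xB)+
  also have "\<dots> = (x + B) ^ Suc m - x ^ Suc m" by (simp add: algebra_simps)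
  finally show ?case .
qed simp

text \<open>Of the mixed monomials only the extreme ones are kept. With n = m - 1 they become the
  two error terms: B x^n, summed over b, gives the higher power of l, and B^m occurs l - 1
  times.\<close>

lemma power_add_diff_le:
  fixes x B :: real
  assumes "x \<ge> 0" "B \<ge> 0"
  shows "(x + B) ^ Suc n - x ^ Suc n \<le> real (Suc n) * 2 ^ n * (B * x ^ n + B ^ Suc n)"
proof -
  have "(x + B) ^ Suc n - x ^ Suc n = B * (\<Sum>i<Suc n. (x + B) ^ i * x ^ (n - i))"
    using diff_power_eq_sum[of "x + B" n x] by (simp only: add_diff_cancel_left')
  also have "\<dots> \<le> B * (\<Sum>i<Suc n. (x + B) ^ n)"
  proof (intro mult_left_mono sum_mono assms)
    fix i assume "i \<in> {..<Suc n}"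
    then have "(x + B) ^ n = (x + B) ^ i * (x + B) ^ (n - i)" by (simp flip: power_add)
    then show "(x + B) ^ i * x ^ (n - i) \<le> (x + B) ^ n"
      using assms by (auto intro!: mult_left_mono power_mono)
  qed
  also have "\<dots> = real (Suc n) * (B * (x + B) ^ n)" by simp
  also have "\<dots> \<le> real (Suc n) * (B * (2 ^ n * (x ^ n + B ^ n)))"
  proof (intro mult_left_mono assms)
    show "(x + B) ^ n \<le> 2 ^ n * (x ^ n + B ^ n)"
    proof -
    have "(x + B) ^ n \<le> (2 * max x B) ^ n" using assms by (intro power_mono) auto
    also have "\<dots> = 2 ^ n * max x B ^ n" by (simp add: power_mult_distrib)
    also have "max x B ^ n \<le> x ^ n + B ^ n" using assms by (simp add: max_def)
    finally show ?thesis by simp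
    qed
  qed simp
  finally show ?thesis by (simp add: algebra_simps)
qed

text \<open>A telescoping majorant in place of the integral test. From v <= 3/2 u one gets u v (v +
  u) <= 15/4 u^3, rounded up to 6.\<close>

lemma powr_minus_three_halves_le:
  fixes x :: real
  assumes "x \<ge> 1"
  shows "x powr (- (3 / 2)) \<le> 6 * (1 / sqrt x - 1 / sqrt (x + 1))"
proof -
  define u v where "u = sqrt x" and "v = sqrt (x + 1)"
  have u: "u > 0" "u \<le> v" "v > 0" using assms by (auto simp: u_def v_def)
  have v2: "v \<le> 3 / 2 * u"
  proof -
    have "v \<le> sqrt ((9 / 4) * x)" unfolding v_def using assms by simp
    also have "\<dots> = 3 / 2 * u" by (simp add: u_def real_sqrt_mult real_sqrt_divide)
    finally show ?thesis .
  qed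
  have uv: "(v - u) * (v + u) = 1" using assms by (simp add: u_def v_def algebra_simps)
  then have d: "v - u = 1 / (v + u)" using u by (simp add: field_simps)
  have "1 / u - 1 / v = (v - u) / (u * v)" using u by (simp add: field_simps)
  then have "1 / u - 1 / v = 1 / (u * v * (v + u))" by (simp add: d)
  moreover have "u * v * (v + u) \<le> 6 * u ^ 3"
  proof -
    have "u * v * (v + u) \<le> u * (3 / 2 * u) * (3 / 2 * u + u)"
      using u v2 by (intro mult_mono add_mono) auto
    also have "\<dots> = 15 / 4 * u ^ 3" by (simp add: power3_eq_cube algebra_simps)
    also have "\<dots> \<le> 6 * u ^ 3" using u by simp
    finally show ?thesis .
  qed
  then have "1 / (6 * u ^ 3) \<le> 1 / (u * v * (v + u))"
    using u by (intro divide_left_mono mult_pos_pos) auto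
  ultimately have "6 * (1 / u - 1 / v) \<ge> 6 * (1 / (6 * u ^ 3))" by simp
  moreover have "x powr (- (3 / 2)) = 1 / u ^ 3"
  proof -
    have "u ^ 3 = (x powr (1 / 2)) ^ 3" using assms by (simp add: u_def powr_half_sqrt)
    also have "\<dots> = x powr (3 / 2)" using assms powr_power[of x "1 / 2" 3] by simp
    finally show ?thesis by (simp only: powr_minus inverse_eq_divide)
  qed
  ultimately show ?thesis by (simp add: u_def v_def)
qed

text \<open>For n >= l and \<alpha> >= 3/2 the factor n^(3/2-\<alpha>) is at most l^(3/2-\<alpha>),
  which reduces every exponent to 3/2, where the majorant telescopes to 6 l^(-1/2). After
  multiplication by l^\<alpha> the truncation costs only O(l).\<close>

lemma tail_sum_bound:
  fixes c :: "nat \<Rightarrow> complex" and \<alpha> :: real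
  assumes c: "\<And>n. norm (c n) \<le> 1" and l: "l > 0" and \<alpha>: "\<alpha> \<ge> 3 / 2"
  shows "norm ((\<Sum>b=1..l-1. c b * of_nat b powr (- of_real \<alpha>)) - (\<Sum>k. c (Suc k) * of_nat (Suc k) powr (- of_real \<alpha>)))
    \<le> 6 * real l powr (1 - \<alpha>)"
proof -
  define t where "t = (\<lambda>k. c (Suc k) * of_nat (Suc k) powr (- complex_of_real \<alpha>))"
  have nt: "norm (t k) \<le> real (Suc k) powr (- \<alpha>)" for k
  proof -
    have "norm (of_nat (Suc k) powr (- complex_of_real \<alpha>)) = real (Suc k) powr (- \<alpha>)"
      using norm_of_real_powr[of "real (Suc k)" "- complex_of_real \<alpha>"] by simp
    then show ?thesis using c[of "Suc k"] by (simp only: t_def norm_mult mult_left_le_one_le powr_ge_zero norm_ge_zero)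
  qed
  have "summable (\<lambda>k. real (Suc k) powr (- \<alpha>))"
    using \<alpha> by (subst summable_Suc_iff) (simp add: summable_real_powr_iff)
  then have "summable t" by (rule summable_comparison_test') (use nt in auto)
  then have "t sums (\<Sum>k. t k)" by (rule summable_sums)
  \<comment> \<open>Index k stands for n = k + 1, so discarding l - 1 terms starts the tail at n =
    l.\<close>
  from sums_split_initial_segment[OF this, of "l - 1"]
  have tl: "(\<lambda>i. t (i + (l - 1))) sums ((\<Sum>k. t k) - (\<Sum>k<l - 1. t k))" .
  define w where "w = (\<lambda>i. 1 / sqrt (real (i + l)))"
  have "w \<longlonglongrightarrow> 0" unfolding w_def by real_asymp
  from sums_mult[OF telescope_sums'[OF this], of "real l powr (3 / 2 - \<alpha>) * 6"]
  have tel: "(\<lambda>i. real l powr (3 / 2 - \<alpha>) * 6 * (w i - w (Suc i))) sums (real l powr (3 / 2 - \<alpha>) * 6 * w 0)"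
    by simp
  have "norm ((\<Sum>k. t k) - (\<Sum>k<l - 1. t k)) \<le> real l powr (3 / 2 - \<alpha>) * 6 * w 0"
  proof (rule norm_sums_le[OF tl tel])
    fix i
    define n where "n = i + l"
    have n: "real n \<ge> 1" "real l \<le> real n" using l by (auto simp: n_def)
    have "norm (t (i + (l - 1))) \<le> real n powr (- \<alpha>)"
      using nt[of "i + (l - 1)"] l by (simp add: n_def)
    also have "\<dots> = real n powr (3 / 2 - \<alpha>) * real n powr (- (3 / 2))"
      by (simp flip: powr_add)
    also have "\<dots> \<le> real l powr (3 / 2 - \<alpha>) * (6 * (1 / sqrt (real n) - 1 / sqrt (real n + 1)))"
      using n l \<alpha> by (intro mult_mono powr_minus_three_halves_le powr_mono2') auto
    also have "1 / sqrt (real n) = w i" by (simp add: w_def n_def)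
    also have "1 / sqrt (real n + 1) = w (Suc i)" by (simp add: w_def n_def add_ac)
    finally show "norm (t (i + (l - 1))) \<le> real l powr (3 / 2 - \<alpha>) * 6 * (w i - w (Suc i))"
      by (simp only: mult.assoc)
  qed
  also have "w 0 = real l powr (- (1 / 2))"
    using l by (simp add: w_def powr_minus powr_half_sqrt inverse_eq_divide)
  also have "real l powr (3 / 2 - \<alpha>) * 6 * real l powr (- (1 / 2)) = 6 * real l powr (1 - \<alpha>)"
    by (simp flip: powr_add)
  finally have "norm ((\<Sum>k. t k) - (\<Sum>k<l - 1. t k)) \<le> 6 * real l powr (1 - \<alpha>)" .
  moreover have "(\<Sum>k<l - 1. t k) = (\<Sum>b=1..l-1. c b * of_nat b powr (- of_real \<alpha>))"
    unfolding t_def by (rule sum.reindex_bij_witness[of _ "\<lambda>b. b - 1" Suc]) auto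
  ultimately show ?thesis by (simp add: t_def norm_minus_commute)
qed

text \<open>The exponent p = (m - 1)/2 belongs to the mixed error term. For m = 3 it is exactly 1,
  the logarithmically divergent case, and this is the source of the \<epsilon> in the exponent of
  l.\<close>

lemma sum_powr_le_harm:
  fixes l :: nat and p \<epsilon> :: real
  assumes p: "p \<ge> 1" and \<epsilon>: "\<epsilon> > 0" and l: "l > 0"
  shows "(\<Sum>b=1..l-1. real b powr (- p)) \<le> (1 + 1 / \<epsilon>) * real l powr \<epsilon>"
proof -
  have "(\<Sum>b=1..l-1. real b powr (- p)) \<le> (\<Sum>b=1..l. 1 / real b)"
  proof (intro order_trans[OF sum_mono sum_mono2])
    fix b assume b: "b \<in> {1..l-1}"
    then have "real b powr (- p) \<le> real b powr (- 1)" using p by (intro powr_mono) auto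
    then show "real b powr (- p) \<le> 1 / real b" using b by (simp add: powr_minus inverse_eq_divide)
  qed auto
  also have "\<dots> = harm l" by (simp add: harm_def inverse_eq_divide)
  also have "\<dots> \<le> 1 + ln (real l)" by (rule harm_le_ln[OF l])
  also have "ln (real l) \<le> real l powr \<epsilon> / \<epsilon>" using l \<epsilon> by (intro ln_powr_bound) auto
  also have "1 \<le> real l powr \<epsilon>" using l \<epsilon> by (simp add: ge_one_powr_ge_zero)
  finally show ?thesis by (simp add: algebra_simps)
qed

text \<open>The product character enters only as a bounded periodic function, with the product of
  all moduli as a common period.\<close>

lemma product_character_bounds:
  fixes m :: nat
  assumes chi: "\<And>i. i < m \<Longrightarrow> dirichlet_character (q i) (chi i)" and psi: "dirichlet_character l psi"
  defines "c \<equiv> \<lambda>n. (\<Prod>i<m. chi i n) * psi n"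
  shows "norm (c n) \<le> 1" and "c (n + (\<Prod>i<m. q i) * l) = c n" and "(\<Prod>i<m. q i) * l > 0"
proof -
  have "norm (\<Prod>i<m. chi i n) \<le> 1"
    unfolding prod_norm[symmetric] using norm_dirichlet_character_le[OF chi] by (intro prod_le_1) auto
  then show "norm (c n) \<le> 1"
    unfolding c_def norm_mult using norm_dirichlet_character_le[OF psi, of n] by (intro mult_le_one) auto
  have per: "phi (n + k * r) = phi n" if "dirichlet_character r phi" for phi r k
    using periodic_add_mult[of phi r, OF dirichlet_characterD(2)[OF that], of n k] by (simp add: mult.commute)
  have "chi i (n + (\<Prod>i<m. q i) * l) = chi i n" if "i < m" for i
  proof -
    have "(\<Prod>i<m. q i) = q i * (\<Prod>j\<in>{..<m} - {i}. q j)" using that by (intro prod.remove) auto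
    then have "n + (\<Prod>i<m. q i) * l = n + ((\<Prod>j\<in>{..<m} - {i}. q j) * l) * q i" by simp
    then show ?thesis using per[OF chi[OF that]] by metis
  qed
  then have "(\<Prod>i<m. chi i (n + (\<Prod>i<m. q i) * l)) = (\<Prod>i<m. chi i n)" by (intro prod.cong) auto
  then show "c (n + (\<Prod>i<m. q i) * l) = c n" unfolding c_def using per[OF psi] by simp
  show "(\<Prod>i<m. q i) * l > 0"
    using dirichlet_characterD(1)[OF chi] dirichlet_characterD(1)[OF psi] by (simp add: prod_pos)
qed

text \<open>Only the pointwise approximation of \<open>L i b\<close> is used. Its exponent
  \<epsilon>/m is chosen so that the m-th power of \<open>B\<close> carries exactly \<epsilon>. The
  main terms form l^(m/2) times a truncated series because (l/b)^(1/2) has m-th power l^(m/2)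
  b^(-m/2).\<close>

lemma mean_value_bound:
  fixes m :: nat and \<epsilon> K qs :: real
  assumes m: "m \<ge> 3" and \<epsilon>: "\<epsilon> > 0" and K: "K \<ge> 1" and qs: "qs \<ge> 1"
    and chi: "\<And>i. i < m \<Longrightarrow> dirichlet_character (q i) (chi i)" and psi: "dirichlet_character l psi"
    and L: "\<And>i b. i < m \<Longrightarrow> 1 \<le> b \<Longrightarrow> b < l \<Longrightarrow>
      norm (L i b - chi i b * of_real (sqrt (real l / real b))) \<le> K * qs powr (1 / 4 + \<epsilon> / real m)"
  shows "norm ((\<Sum>b=1..l-1. psi b * (\<Prod>i<m. L i b)) - of_real (real l powr (real m / 2)) *
       dirichlet_L (\<lambda>n. (\<Prod>i<m. chi i n) * psi n) (of_real (real m / 2)))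
    \<le> (real m * 2 ^ m * K ^ m * (1 + 1 / \<epsilon>) + 6) *
       (qs powr (real m / 4 + \<epsilon>) * real l + qs powr (1 / 4 + \<epsilon>) * real l powr (real m / 2 - 1 / 2 + \<epsilon>))"
proof -
  define c where "c = (\<lambda>n. (\<Prod>i<m. chi i n) * psi n)"
  have c: "norm (c k) \<le> 1" "c (k + (\<Prod>i<m. q i) * l) = c k" "(\<Prod>i<m. q i) * l > 0" for k
    unfolding c_def using product_character_bounds[of m q chi l psi, OF chi psi] by blast+
  define B where "B = K * qs powr (1 / 4 + \<epsilon> / real m)"
  define x where "x = (\<lambda>b::nat. sqrt (real l / real b))"
  define \<alpha> where "\<alpha> = real m / 2"
  have l: "l > 0" using psi by (rule dirichlet_characterD)
  have \<alpha>: "\<alpha> \<ge> 3 / 2" using m by (simp add: \<alpha>_def)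
  have B: "B \<ge> 0" using K by (simp add: B_def)
  obtain n where n: "m = Suc n" "n \<ge> 2" using m by (cases m) auto
  have x_pow: "x b ^ k = real l powr (real k / 2) * real b powr (- (real k / 2))" if "b \<ge> 1" for b k
  proof -
    have "real l / real b > 0" using l that by simp
    then have "x b ^ k = ((real l / real b) powr (1 / 2)) powr real k"
      by (simp add: x_def powr_half_sqrt powr_realpow)
    also have "\<dots> = (real l / real b) powr (real k / 2)" by (simp add: powr_powr)
    finally have "x b ^ k = (real l / real b) powr (real k / 2)" .
    then show ?thesis using l that by (simp add: powr_divide powr_minus inverse_eq_divide)
  qed
  have main: "c b * of_nat b powr (- of_real \<alpha>) * of_real (real l powr \<alpha>) = psi b * (\<Prod>i<m. chi i b * of_real (x b))"
    if "b \<ge> 1" for b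
  proof -
    have "of_nat b powr (- complex_of_real \<alpha>) = of_real (real b powr (- \<alpha>))"
      using powr_of_real[of "real b" "- \<alpha>"] by simp
    then have "of_nat b powr (- complex_of_real \<alpha>) * of_real (real l powr \<alpha>) = of_real (x b) ^ m"
      using x_pow[OF that, of m] by (simp add: \<alpha>_def flip: of_real_power of_real_mult)
    then show ?thesis by (simp add: c_def prod.distrib mult_ac)
  qed
  have diff: "norm (psi b * (\<Prod>i<m. L i b) - psi b * (\<Prod>i<m. chi i b * of_real (x b)))
      \<le> real m * 2 ^ n * (B * x b ^ n + B ^ m)" if b: "b \<in> {1..l-1}" for b
  proof -
    have b': "1 \<le> b" "b < l" using b l by auto
    have x0: "x b \<ge> 0" by (simp add: x_def)
    have "norm ((\<Prod>i<m. chi i b * of_real (x b) + (L i b - chi i b * of_real (x b))) - (\<Prod>i<m. chi i b * of_real (x b)))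
        \<le> (x b + B) ^ m - x b ^ m"
    proof (rule norm_prod_add_diff_le)
      fix i assume i: "i < m"
      show "norm (chi i b * of_real (x b)) \<le> x b"
        using norm_dirichlet_character_le[OF chi[OF i], of b] x0 by (simp add: norm_mult mult_left_le_one_le)
      show "norm (L i b - chi i b * of_real (x b)) \<le> B"
        unfolding x_def B_def by (rule L[OF i b'])
    qed
    also have "\<dots> \<le> real m * 2 ^ n * (B * x b ^ n + B ^ m)"
      unfolding n(1) by (rule power_add_diff_le[OF x0 B])
    finally have 1: "norm ((\<Prod>i<m. L i b) - (\<Prod>i<m. chi i b * of_real (x b))) \<le> real m * 2 ^ n * (B * x b ^ n + B ^ m)"
      by simp
    have "norm (psi b * ((\<Prod>i<m. L i b) - (\<Prod>i<m. chi i b * of_real (x b)))) \<le> norm ((\<Prod>i<m. L i b) - (\<Prod>i<m. chi i b * of_real (x b)))"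
      using norm_dirichlet_character_le[OF psi, of b] by (simp add: norm_mult mult_left_le_one_le)
    with 1 show ?thesis by (simp add: right_diff_distrib)
  qed
  have xsum: "(\<Sum>b=1..l-1. x b ^ n) \<le> (1 + 1 / \<epsilon>) * real l powr (real m / 2 - 1 / 2 + \<epsilon>)"
  proof -
    have "(\<Sum>b=1..l-1. x b ^ n) = (\<Sum>b=1..l-1. real l powr (real n / 2) * real b powr (- (real n / 2)))"
      by (intro sum.cong refl x_pow) auto
    also have "\<dots> \<le> real l powr (real n / 2) * ((1 + 1 / \<epsilon>) * real l powr \<epsilon>)"
      unfolding sum_distrib_left[symmetric] using n by (intro mult_left_mono sum_powr_le_harm \<epsilon> l) auto
    also have "\<dots> = (1 + 1 / \<epsilon>) * real l powr (real n / 2 + \<epsilon>)" by (simp add: powr_add)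
    also have "real n / 2 = real m / 2 - 1 / 2" by (simp add: n(1) field_simps)
    finally show ?thesis .
  qed
  \<comment> \<open>The mixed term contains a single factor \<open>B\<close>, so \<epsilon>/m is
    simply enlarged to \<epsilon>; K <= K^m lets both error terms share a constant.\<close>
  have B1: "B \<le> K ^ m * qs powr (1 / 4 + \<epsilon>)"
    unfolding B_def
  proof (intro mult_mono powr_mono)
    show "K \<le> K ^ m" using K m by (intro self_le_power) auto
    show "1 / 4 + \<epsilon> / real m \<le> 1 / 4 + \<epsilon>" using m \<epsilon> by (simp add: divide_le_eq mult_left_mono)
  qed (use K qs in auto)
  have Bm: "B ^ m = K ^ m * qs powr (real m / 4 + \<epsilon>)"
  proof -
    have "real m * (1 / 4 + \<epsilon> / real m) = real m / 4 + \<epsilon>" using m by (simp add: field_simps)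
    then have "(qs powr (1 / 4 + \<epsilon> / real m)) ^ m = qs powr (real m / 4 + \<epsilon>)"
      using qs powr_power[of qs "1 / 4 + \<epsilon> / real m" m] by simp
    then show ?thesis by (simp only: B_def power_mult_distrib)
  qed
  define E where "E = qs powr (real m / 4 + \<epsilon>) * real l"
  define F where "F = qs powr (1 / 4 + \<epsilon>) * real l powr (real m / 2 - 1 / 2 + \<epsilon>)"
  have EF: "E \<ge> 0" "F \<ge> 0" by (auto simp: E_def F_def)
  have S1: "norm ((\<Sum>b=1..l-1. psi b * (\<Prod>i<m. L i b)) - (\<Sum>b=1..l-1. psi b * (\<Prod>i<m. chi i b * of_real (x b))))
      \<le> real m * 2 ^ m * K ^ m * (1 + 1 / \<epsilon>) * (E + F)"
  proof -
    have "norm ((\<Sum>b=1..l-1. psi b * (\<Prod>i<m. L i b)) - (\<Sum>b=1..l-1. psi b * (\<Prod>i<m. chi i b * of_real (x b))))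
        \<le> (\<Sum>b=1..l-1. real m * 2 ^ n * (B * x b ^ n + B ^ m))"
      unfolding sum_subtractf[symmetric] by (intro sum_norm_le diff)
    also have "\<dots> = real m * 2 ^ n * (B * (\<Sum>b=1..l-1. x b ^ n) + real (l - 1) * B ^ m)"
      by (simp add: sum_distrib_left[symmetric] sum.distrib)
    also have "\<dots> \<le> real m * 2 ^ m * ((K ^ m * qs powr (1 / 4 + \<epsilon>)) * ((1 + 1 / \<epsilon>) * real l powr (real m / 2 - 1 / 2 + \<epsilon>))
        + real l * B ^ m)"
      using B B1 xsum K \<epsilon>
      by (intro mult_mono add_mono) (auto simp: n(1) x_def intro!: sum_nonneg add_nonneg_nonneg mult_nonneg_nonneg)
    also have "\<dots> = real m * 2 ^ m * K ^ m * ((1 + 1 / \<epsilon>) * F + E)"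
      by (simp add: Bm E_def F_def algebra_simps)
    \<comment> \<open>\<open>E\<close> is given the factor 1 + 1/\<epsilon> as well, only to pull
      out one common constant.\<close>
    also have "\<dots> \<le> real m * 2 ^ m * K ^ m * ((1 + 1 / \<epsilon>) * F + (1 + 1 / \<epsilon>) * E)"
      using EF \<epsilon> K by (intro mult_left_mono add_mono) (auto simp: algebra_simps)
    also have "(1 + 1 / \<epsilon>) * F + (1 + 1 / \<epsilon>) * E = (1 + 1 / \<epsilon>) * (E + F)"
      by (simp only: distrib_left add.commute)
    finally show ?thesis by (simp only: mult.assoc)
  qed
  have "dirichlet_L c (of_real \<alpha>) = (\<Sum>k. c (Suc k) * of_nat (Suc k) powr (- of_real \<alpha>))"
    using \<alpha> by (intro dirichlet_L_eq_suminf[where c = c, OF c(3,2,1)]) auto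
  then have tail: "norm ((\<Sum>b=1..l-1. c b * of_nat b powr (- of_real \<alpha>)) - dirichlet_L c (of_real \<alpha>)) \<le> 6 * real l powr (1 - \<alpha>)"
    using tail_sum_bound[of c l \<alpha>, OF c(1) l \<alpha>] by simp
  have S2: "norm ((\<Sum>b=1..l-1. psi b * (\<Prod>i<m. chi i b * of_real (x b))) - of_real (real l powr \<alpha>) * dirichlet_L c (of_real \<alpha>))
      \<le> 6 * (E + F)"
  proof -
    have "(\<Sum>b=1..l-1. psi b * (\<Prod>i<m. chi i b * of_real (x b)))
        = of_real (real l powr \<alpha>) * (\<Sum>b=1..l-1. c b * of_nat b powr (- of_real \<alpha>))"
      unfolding sum_distrib_left
    proof (intro sum.cong refl)
      fix b assume "b \<in> {1..l-1}"
      then have "b \<ge> 1" by simp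
      from main[OF this] show "psi b * (\<Prod>i<m. chi i b * of_real (x b))
          = of_real (real l powr \<alpha>) * (c b * of_nat b powr (- of_real \<alpha>))"
        by (simp only: mult_ac)
    qed
    then have "norm ((\<Sum>b=1..l-1. psi b * (\<Prod>i<m. chi i b * of_real (x b))) - of_real (real l powr \<alpha>) * dirichlet_L c (of_real \<alpha>))
        = real l powr \<alpha> * norm ((\<Sum>b=1..l-1. c b * of_nat b powr (- of_real \<alpha>)) - dirichlet_L c (of_real \<alpha>))"
      by (simp add: norm_mult flip: right_diff_distrib)
    \<comment> \<open>What remains is 6 l, absorbed by \<open>E\<close> since qs >= 1; this is the
      summand 6 of the constant. For l = 1 the sum over b is empty and the same bound covers the
      whole L-value.\<close>
    also have "\<dots> \<le> real l powr \<alpha> * (6 * real l powr (1 - \<alpha>))" by (intro mult_left_mono tail) auto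
    also have "\<dots> = 6 * real l" using l by (simp flip: powr_add)
    also have "\<dots> \<le> 6 * (E + F)"
    proof -
      have "1 \<le> qs powr (real m / 4 + \<epsilon>)" using qs \<epsilon> by (intro ge_one_powr_ge_zero) auto
      then have "1 * real l \<le> E" unfolding E_def by (intro mult_right_mono) auto
      then show ?thesis using EF by simp
    qed
    finally show ?thesis .
  qed
  have "norm ((\<Sum>b=1..l-1. psi b * (\<Prod>i<m. L i b)) - of_real (real l powr \<alpha>) * dirichlet_L c (of_real \<alpha>))
      \<le> real m * 2 ^ m * K ^ m * (1 + 1 / \<epsilon>) * (E + F) + 6 * (E + F)"
    using norm_triangle_mono[OF S1 S2] by simp
  then show ?thesis by (simp add: c_def E_def F_def \<alpha>_def algebra_simps)
qed

theorem theorem3p3: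
  fixes m :: nat and \<epsilon> :: real
  assumes "m \<ge> 3" and "\<epsilon> > 0"
  shows "\<exists>C::real. \<forall>(q :: nat \<Rightarrow> nat) (chi :: nat \<Rightarrow> nat \<Rightarrow> complex) (l :: nat) (psi :: nat \<Rightarrow> complex).
     (\<forall>i<m. dirichlet_character (q i) (chi i)) \<longrightarrow> dirichlet_character l psi \<longrightarrow>
     (let qstar = real (Max (q ` {..<m})) in
       norm ((\<Sum>b=1..l-1. psi b * (\<Prod>i<m. hurwitz_L (chi i) b l (1/2)))
             - of_real (real l powr (real m / 2)) *
               dirichlet_L (\<lambda>n. (\<Prod>i<m. chi i n) * psi n) (of_real (real m / 2)))
       \<le> C * (qstar powr (real m / 4 + \<epsilon>) * real l
              + qstar powr (1/4 + \<epsilon>) * real l powr (real m / 2 - 1/2 + \<epsilon>)))"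
proof -
  \<comment> \<open>\<open>K\<close> is obtained for \<epsilon>/m before any moduli or characters
    are introduced, so the final constant depends on m and \<epsilon> alone.\<close>
  have \<epsilon>m: "\<epsilon> / real m > 0" using assms by simp
  obtain K where K: "K \<ge> 1"
    "\<And>q chi b l. dirichlet_character q chi \<Longrightarrow> 1 \<le> b \<Longrightarrow> b < l \<Longrightarrow>
      norm (hurwitz_L chi b l (1 / 2) - chi b * of_real (sqrt (real l / real b))) \<le> K * real q powr (1 / 4 + \<epsilon> / real m)"
    using hurwitz_L_half_bound[OF \<epsilon>m] by blast
  show ?thesis
    unfolding Let_def
  proof (intro exI[of _ "real m * 2 ^ m * K ^ m * (1 + 1 / \<epsilon>) + 6"] allI impI mean_value_bound)
    fix q :: "nat \<Rightarrow> nat" and chi :: "nat \<Rightarrow> nat \<Rightarrow> complex" and l psi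
    assume chi: "\<forall>i<m. dirichlet_character (q i) (chi i)" and psi: "dirichlet_character l psi"
    have q_le: "q i \<le> Max (q ` {..<m})" if "i < m" for i using that by (intro Max_ge) auto
    have "q 0 > 0" using dirichlet_characterD(1)[OF chi[rule_format, of 0]] assms(1) by simp
    then show "1 \<le> real (Max (q ` {..<m}))" using order.strict_trans2[OF _ q_le[of 0]] assms(1) by (simp add: Suc_le_eq)
    show "dirichlet_character (q i) (chi i)" if "i < m" for i using chi that by blast
    fix i b assume ib: "i < m" "1 \<le> b" "b < l"
    have "norm (hurwitz_L (chi i) b l (1 / 2) - chi i b * of_real (sqrt (real l / real b))) \<le> K * real (q i) powr (1 / 4 + \<epsilon> / real m)"
      using chi ib by (intro K(2)) auto
    also have "\<dots> \<le> K * real (Max (q ` {..<m})) powr (1 / 4 + \<epsilon> / real m)"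
      using K(1) q_le[OF ib(1)] \<epsilon>m by (intro mult_left_mono powr_mono2) auto
    finally show "norm (hurwitz_L (chi i) b l (1 / 2) - chi i b * of_real (sqrt (real l / real b)))
        \<le> K * real (Max (q ` {..<m})) powr (1 / 4 + \<epsilon> / real m)" .
  qed (use assms K in auto)
qed

end
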